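(* Let $1\le p<\infty$ and let $Y$ be an $L$-quasiconvex metric space with a complete Borel measure $\nu$ such that $0<\nu(B)<\infty$ for all balls. Assume that $\nu$ is doubling and supports a $p$-Poincaré inequality, both for balls of radii at most $R_0$. Let $R_1>0$. Then $\nu$ supports a $p$-Poincaré inequality with dilation $L$ for balls of radii at most $R_1$.
   Context: $L$-quasiconvex: any $x,y$ are joined by a curve of length $\le L\,d(x,y)$. Doubling for balls of radii at most $R_0$: $0<\nu(B(x,2r))\le C_d\nu(B(x,r))<\infty$ for all $x$ and $0<r\le R_0$. Upper gradient of $u$: Borel $g\ge0$ with $|u(\gamma(0))-u(\gamma(l_\gamma))|\le\int_\gamma g\,ds$ for all arc-length parametrized rectifiable curves. $p$-Poincaré inequality with dilation $\lambda\ge1$ for balls of radii at most $R$: there is $C$ such that for all balls $B$ of radius $\le R$, bounded measurable $u$ and upper gradients $g$ of $u$, $\frac1{\nu(B)}\int_B|u-u_B|d\nu\le C\operatorname{diam}(B)(\frac1{\nu(\lambda B)}\int_{\lambda B}g^pd\nu)^{1/p}$, $u_B$ the $\nu$-average of $u$ over $B$. *)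

theory Defs
  imports "HOL-Analysis.Analysis"
begin

definition curve_length :: "(real \<Rightarrow> 'a::metric_space) \<Rightarrow> real \<Rightarrow> real \<Rightarrow> ereal" where
  "curve_length \<gamma> a b =
     (SUP nt \<in> {(n, t::nat \<Rightarrow> real). t 0 = a \<and> t n = b \<and> (\<forall>i<n. t i \<le> t (Suc i))}.
        ereal (\<Sum>i<fst nt. dist (\<gamma> (snd nt i)) (\<gamma> (snd nt (Suc i)))))"

definition quasiconvex :: "real \<Rightarrow> 'a::metric_space set \<Rightarrow> bool" where
  "quasiconvex L Y \<longleftrightarrow> (\<forall>x\<in>Y. \<forall>y\<in>Y. \<exists>\<gamma> a b. a \<le> b \<and> continuous_on {a..b} \<gamma> \<and>
      \<gamma> ` {a..b} \<subseteq> Y \<and> \<gamma> a = x \<and> \<gamma> b = y \<and> curve_length \<gamma> a b \<le> ereal (L * dist x y))"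

definition arclength_curve :: "(real \<Rightarrow> 'a::metric_space) \<Rightarrow> real \<Rightarrow> bool" where
  "arclength_curve \<gamma> l \<longleftrightarrow> 0 \<le> l \<and> continuous_on {0..l} \<gamma> \<and>
      (\<forall>s t. 0 \<le> s \<and> s \<le> t \<and> t \<le> l \<longrightarrow> curve_length \<gamma> s t = ereal (t - s))"

definition upper_gradient :: "('a::metric_space \<Rightarrow> real) \<Rightarrow> ('a \<Rightarrow> ennreal) \<Rightarrow> bool" where
  "upper_gradient u g \<longleftrightarrow> g \<in> borel_measurable borel \<and>
     (\<forall>\<gamma> l. arclength_curve \<gamma> l \<longrightarrow>
        ennreal \<bar>u (\<gamma> 0) - u (\<gamma> l)\<bar> \<le> (\<integral>\<^sup>+ t\<in>{0..l}. g (\<gamma> t) \<partial>lborel))"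

definition ennpow :: "ennreal \<Rightarrow> real \<Rightarrow> ennreal" where
  "ennpow x p = (if x = \<infinity> then \<infinity> else ennreal (enn2real x powr p))"

definition doubling_upto :: "'a::metric_space measure \<Rightarrow> real \<Rightarrow> bool" where
  "doubling_upto \<nu> R0 \<longleftrightarrow> (\<exists>Cd. \<forall>x r. 0 < r \<and> r \<le> R0 \<longrightarrow>
      0 < emeasure \<nu> (ball x (2*r)) \<and>
      emeasure \<nu> (ball x (2*r)) \<le> ennreal Cd * emeasure \<nu> (ball x r) \<and>
      emeasure \<nu> (ball x r) < \<infinity>)"

definition avg :: "'a measure \<Rightarrow> 'a set \<Rightarrow> ('a \<Rightarrow> real) \<Rightarrow> real" where
  "avg \<nu> B u = (LINT x:B|\<nu>. u x) / measure \<nu> B"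

text \<open>p-Poincare inequality with dilation lam for balls of radii at most R.
  If the integral of g^p over lam B is infinite, the inequality holds trivially.\<close>
definition poincare :: "'a::metric_space measure \<Rightarrow> real \<Rightarrow> real \<Rightarrow> real \<Rightarrow> bool" where
  "poincare \<nu> p lam R \<longleftrightarrow> (\<exists>C. \<forall>x r u g.
     0 < r \<and> r \<le> R \<and> u \<in> borel_measurable \<nu> \<and> bounded (range u) \<and> upper_gradient u g \<longrightarrow>
     (let B = ball x r; LB = ball x (lam * r);
          I = (\<integral>\<^sup>+ y\<in>LB. ennpow (g y) p \<partial>\<nu>) in
      I = \<infinity> \<or>
      avg \<nu> B (\<lambda>y. \<bar>u y - avg \<nu> B u\<bar>)
        \<le> C * diameter B * (enn2real I / measure \<nu> LB) powr (1/p)))"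

end

theory Submission
  imports Defs
begin

text \<open>
  A point a of a ball B(x,r) is joined to x by a curve of length at most L d(x,a) < L r, and the point
  at arc length s on it has distance at least L r - s to the complement of B(x,Lr). Hence a is reached
  by a chain of balls centred on the curve whose radii are a small fixed multiple \<delta> of L r - s: they
  decrease geometrically, have bounded shadows, and their dilations stay inside B(x,Lr). If \<delta> is small
  enough, all radii are at most R0, which also yields the passage from R0 to R1. Telescoping the
  averages of u along the chains to a finite net of the slightly smaller ball
  d(x,y) \<le> r (1 - (1 - \<delta>)^K), exchanging the order of summation, and using doubling at all scales
  gives a bound independent of K; letting K tend to infinity no Lebesgue points are needed.
  Doubling beyond R0 follows from quasiconvexity by covering with chains of balls.
\<close>

section \<open>Lipschitz paths and chains\<close>

text \<open>Two obstacles shape the argument. The dilation is exactly \<open>L\<close>, so no ball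
  with its factor \<open>lam\<close> may leave B(x,Lr), although the curve to a point near the
  boundary of B(x,r) can itself come close to the boundary of B(x,Lr); this is what forces the radii
  to shrink with the unspent length. Moreover the right-hand side of the given inequality is a power
  1/p of an integral and cannot be summed over overlapping balls. It is therefore replaced by a
  multiple of the measure (t + g^p) \<nu> restricted to B(x,Lr), where t is the mean of g^p over
  that ball. Both summands have the same total mass, so after summation t^(1/p - 1) times the mean
  of the density, which is 2t, gives back 2 t^(1/p). The chain argument itself only sees an abstract
  finite measure.

  The argument produces the radius where the definition asks for the diameter. The two differ
  essentially only if the ball is the whole space, and then the radius is decreased
  beforehand.\<close>

lemma curve_length_extend:
  assumes "curve_length \<gamma> a t' \<le> ereal c" "t \<le> t'"
  shows "curve_length \<gamma> a t \<le> ereal (c - dist (\<gamma> t) (\<gamma> t'))"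
  unfolding curve_length_def
proof (rule SUP_least, clarsimp)
  fix n and s :: "nat \<Rightarrow> real"
  assume s: "\<forall>i<n. s i \<le> s (Suc i)" and a: "a = s 0" and t: "t = s n"
  \<comment> \<open>Appending \<open>t'\<close> as one more partition point adds exactly the
    distance between the two curve points.\<close>
  define s' where "s' = s(Suc n := t')"
  have "ereal (\<Sum>i<Suc n. dist (\<gamma> (s' i)) (\<gamma> (s' (Suc i)))) \<le> curve_length \<gamma> a t'"
    unfolding curve_length_def
    by (rule SUP_upper2[of "(Suc n, s')"])
       (use s a t assms(2) in \<open>auto simp: s'_def less_Suc_eq\<close>)
  also have "\<dots> \<le> ereal c"
    by fact
  also have "(\<Sum>i<Suc n. dist (\<gamma> (s' i)) (\<gamma> (s' (Suc i)))) =
      (\<Sum>i<n. dist (\<gamma> (s i)) (\<gamma> (s (Suc i)))) + dist (\<gamma> t) (\<gamma> t')"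
    by (simp add: s'_def t)
  finally show "(\<Sum>i<n. dist (\<gamma> (s i)) (\<gamma> (s (Suc i)))) \<le> c - dist (\<gamma> (s n)) (\<gamma> t')"
    using t by simp
qed

lemma curve_length_nonneg: "a \<le> b \<Longrightarrow> 0 \<le> curve_length \<gamma> a b"
  unfolding curve_length_def
  by (rule SUP_upper2[of "(1, \<lambda>i. if i = 0 then a else b)"]) auto

text \<open>The path is the curve evaluated at the last time at which its length does not exceed the
  parameter; this avoids continuity of the length function.\<close>

lemma quasiconvex_Lipschitz_path:
  fixes x y :: "'a::metric_space"
  assumes "quasiconvex L (UNIV :: 'a set)"
  obtains z where "z 0 = x" "z (L * dist x y) = y" "dist x y \<le> L * dist x y"
    "\<And>s t. 0 \<le> s \<Longrightarrow> s \<le> t \<Longrightarrow> t \<le> L * dist x y \<Longrightarrow> dist (z s) (z t) \<le> t - s"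
proof -
  obtain \<gamma> a b where ab: "a \<le> b" and cont: "continuous_on {a..b} \<gamma>"
    and \<gamma>: "\<gamma> a = x" "\<gamma> b = y" and len: "curve_length \<gamma> a b \<le> ereal (L * dist x y)"
    using assms unfolding quasiconvex_def by (metis UNIV_I)
  define P where "P s = {t\<in>{a..b}. curve_length \<gamma> a t \<le> ereal s}" for s
  define T where "T s = Sup (P s)" for s
  \<comment> \<open>The degenerate curve on [a,a] has nonnegative length, so this bound also gives
    \<open>dist x y \<le> L * dist x y\<close>, from which \<open>1 \<le> L\<close> is obtained
    later.\<close>
  have len0: "curve_length \<gamma> a a \<le> ereal (L * dist x y - dist x y)"
    using curve_length_extend[OF len ab] \<gamma> by simp
  have ge: "dist x y \<le> L * dist x y"
    using order_trans[OF curve_length_nonneg[of a a \<gamma>] len0] by simp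
  have "curve_length \<gamma> a a \<le> 0"
  proof -
    have "(\<Sum>i<n. dist (\<gamma> (s i)) (\<gamma> (s (Suc i)))) \<le> 0"
      if s: "\<forall>i<n. s i \<le> s (Suc i)" "s 0 = a" "s n = a" for n and s :: "nat \<Rightarrow> real"
    proof -
      have mono: "s i \<le> s j" if "i \<le> j" "j \<le> n" for i j
        using that
      proof (induction j rule: dec_induct)
        case (step k)
        then show ?case using s(1) by (meson Suc_le_lessD less_imp_le order_trans)
      qed simp
      have "s i = a" if "i \<le> n" for i
        using mono[of 0 i] mono[of i n] that s by simp
      then show ?thesis
        by simp
    qed
    then show ?thesis
      unfolding curve_length_def by (intro SUP_least) (auto simp: zero_ereal_def)
  qed
  then have aP: "a \<in> P s" if "0 \<le> s" for s
    using that ab by (auto simp: P_def intro: order_trans)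
  have bdd: "bdd_above (P s)" for s
    by (rule bdd_aboveI[of _ b]) (auto simp: P_def)
  have T_in: "T s \<in> {a..b}" if "0 \<le> s" for s
    using aP[OF that] bdd unfolding T_def
    by (auto intro!: cSup_upper cSup_least simp: P_def)
  have T_mono: "T s \<le> T t" if "0 \<le> s" "s \<le> t" for s t
    unfolding T_def using aP[OF that(1)] bdd that
    by (intro cSup_subset_mono) (auto simp: P_def intro: order_trans)
  have down: "t \<in> P s" if "t' \<in> P s" "a \<le> t" "t \<le> t'" for s t t'
  proof -
    have "curve_length \<gamma> a t \<le> ereal (s - dist (\<gamma> t) (\<gamma> t'))"
      using that by (intro curve_length_extend) (auto simp: P_def)
    also have "\<dots> \<le> ereal s" by simp
    finally show ?thesis using that by (auto simp: P_def)
  qed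
  \<comment> \<open>\<open>P s\<close> is an interval starting at \<open>a\<close>. Whether it
    contains its supremum \<open>T s\<close> is left open, so only times strictly on either side of
    \<open>T s\<close> are used.\<close>
  have below: "t \<in> P s" if st: "0 \<le> s" "a \<le> t" "t < T s" for s t
  proof -
    obtain t' where "t' \<in> P s" "t < t'"
      using st aP[OF st(1)] less_cSupD[of "P s" t] unfolding T_def by auto
    then show ?thesis using down st by auto
  qed
  have above: "t \<notin> P s" if "T s < t" for s t
    using that bdd unfolding T_def by (meson cSup_upper leD)
  have near: "\<exists>\<eta>>0. \<forall>\<tau>\<in>{a..b}. dist \<tau> t < \<eta> \<longrightarrow> dist (\<gamma> \<tau>) (\<gamma> t) < e" if "t \<in> {a..b}" "0 < e" for t e
    using cont that unfolding continuous_on_iff by blast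
  have Lip: "dist (\<gamma> (T s)) (\<gamma> (T t)) \<le> t - s" if st: "0 \<le> s" "s \<le> t" for s t
  proof (cases "T s = T t")
    case True
    then show ?thesis using st by simp
  next
    case False
    then have lt: "T s < T t" using T_mono[OF st] by simp
    show ?thesis
    proof (rule field_le_epsilon)
      fix e :: real assume e: "0 < e"
      obtain \<eta>1 where \<eta>1: "\<eta>1 > 0" "\<forall>\<tau>\<in>{a..b}. dist \<tau> (T s) < \<eta>1 \<longrightarrow> dist (\<gamma> \<tau>) (\<gamma> (T s)) < e/2"
        using near[OF T_in, of s "e/2"] st e by auto
      obtain \<eta>2 where \<eta>2: "\<eta>2 > 0" "\<forall>\<tau>\<in>{a..b}. dist \<tau> (T t) < \<eta>2 \<longrightarrow> dist (\<gamma> \<tau>) (\<gamma> (T t)) < e/2"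
        using near[OF T_in, of t "e/2"] st e by auto
      \<comment> \<open>\<sigma> lies just after \<open>T s\<close> and \<tau> just before
        \<open>T t\<close>: the length up to \<sigma> exceeds s and the length up to \<tau> is at
        most t, so the two curve points are less than t - s apart. Continuity carries this to
        \<open>T s\<close> and \<open>T t\<close>; a third of the gap keeps \<sigma> \<le>
        \<tau>.\<close>
      define h where "h = Min {\<eta>1/2, \<eta>2/2, (T t - T s)/3}"
      have h: "0 < h" "h < \<eta>1" "h < \<eta>2" "h \<le> (T t - T s)/3"
        using \<eta>1(1) \<eta>2(1) lt by (auto simp: h_def min_def)
      define \<sigma> \<tau> where "\<sigma> = T s + h" and "\<tau> = T t - h"
      have in_ab: "\<sigma> \<in> {a..b}" "\<tau> \<in> {a..b}" and "\<sigma> \<le> \<tau>"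
        using T_in[of s] T_in[of t] st h by (auto simp: \<sigma>_def \<tau>_def)
      have "\<tau> \<in> P t"
        using below[of t \<tau>] st in_ab h by (auto simp: \<tau>_def)
      then have "curve_length \<gamma> a \<sigma> \<le> ereal (t - dist (\<gamma> \<sigma>) (\<gamma> \<tau>))"
        using \<open>\<sigma> \<le> \<tau>\<close> by (intro curve_length_extend) (auto simp: P_def)
      moreover have "\<not> curve_length \<gamma> a \<sigma> \<le> ereal s"
        using above[of s \<sigma>] h in_ab by (auto simp: P_def \<sigma>_def)
      ultimately have "ereal s < ereal (t - dist (\<gamma> \<sigma>) (\<gamma> \<tau>))"
        by (meson le_less_trans not_le less_le_trans)
      then have "dist (\<gamma> \<sigma>) (\<gamma> \<tau>) < t - s"
        by simp
      moreover have "dist (\<gamma> \<sigma>) (\<gamma> (T s)) < e/2"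
        using \<eta>1(2)[rule_format, OF in_ab(1)] h by (auto simp: \<sigma>_def dist_real_def)
      moreover have "dist (\<gamma> \<tau>) (\<gamma> (T t)) < e/2"
        using \<eta>2(2)[rule_format, OF in_ab(2)] h by (auto simp: \<tau>_def dist_real_def)
      ultimately show "dist (\<gamma> (T s)) (\<gamma> (T t)) \<le> t - s + e"
        using dist_triangle[of "\<gamma> (T s)" "\<gamma> (T t)" "\<gamma> \<sigma>"] dist_triangle[of "\<gamma> \<sigma>" "\<gamma> (T t)" "\<gamma> \<tau>"]
        by (simp add: dist_commute)
    qed
  qed
  \<comment> \<open>\<open>T 0\<close> lies beyond \<open>a\<close> if the curve rests at x for a
    while. Up to any earlier time the length is still 0, so the curve is at x there, and continuity
    gives the value at \<open>T 0\<close>.\<close>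
  have T0: "\<gamma> (T 0) = x"
  proof -
    have "dist (\<gamma> (T 0)) x \<le> 0"
    proof (rule field_le_epsilon)
      fix e :: real assume e: "0 < e"
      show "dist (\<gamma> (T 0)) x \<le> 0 + e"
      proof (cases "T 0 = a")
        case True
        then show ?thesis using \<gamma> e by simp
      next
        case False
        then have lt: "a < T 0" using T_in[of 0] by simp
        obtain \<eta> where \<eta>: "\<eta> > 0" "\<forall>\<tau>\<in>{a..b}. dist \<tau> (T 0) < \<eta> \<longrightarrow> dist (\<gamma> \<tau>) (\<gamma> (T 0)) < e"
          using near[OF T_in, of 0 e] e by auto
        define \<tau> where "\<tau> = max a (T 0 - \<eta>/2)"
        have \<tau>: "\<tau> \<in> {a..b}" "\<tau> < T 0" "dist \<tau> (T 0) < \<eta>"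
          using lt \<eta>(1) T_in[of 0] by (auto simp: \<tau>_def max_def dist_real_def)
        have "\<tau> \<in> P 0"
          using below[of 0 \<tau>] \<tau> by auto
        then have "curve_length \<gamma> a a \<le> ereal (0 - dist (\<gamma> a) (\<gamma> \<tau>))"
          by (intro curve_length_extend) (auto simp: P_def zero_ereal_def)
        then have "0 \<le> ereal (0 - dist (\<gamma> a) (\<gamma> \<tau>))"
          using curve_length_nonneg[of a a \<gamma>] by (rule order_trans[rotated]) simp
        then have "\<gamma> \<tau> = x"
          using \<gamma> by simp
        then show ?thesis
          using \<eta>(2) \<tau> by (force simp: dist_commute)
      qed
    qed
    then show ?thesis by simp
  qed
  have "T (L * dist x y) = b"
  proof -
    have "b \<in> P (L * dist x y)"
      using len ab by (simp add: P_def)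
    then have "b \<le> T (L * dist x y)"
      unfolding T_def using bdd by (rule cSup_upper)
    moreover have "0 \<le> L * dist x y"
      using ge zero_le_dist[of x y] by linarith
    ultimately show ?thesis
      using T_in[of "L * dist x y"] by auto
  qed
  with T0 ge Lip \<gamma> show ?thesis
    by (intro that[of "\<lambda>s. \<gamma> (T s)"]) auto
qed

text \<open>At parameter L r (1 - (1 - \<delta>)^k) the unspent part of the length L r is L r (1 -
  \<delta>)^k, and the next step spends the fraction \<delta> of it. The hypothesis on
  \<open>dist x a\<close> says that a path of parameter length \<open>L * dist x a\<close> is used
  up after K such steps.\<close>

lemma quasiconvex_chain:
  fixes x a :: "'a::metric_space"
  assumes qc: "quasiconvex L (UNIV :: 'a set)" and L: "1 \<le> L"
    and \<delta>: "0 < \<delta>" "\<delta> < 1" and r: "0 < r" and a: "dist x a \<le> r * (1 - (1 - \<delta>) ^ K)"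
  obtains z :: "nat \<Rightarrow> 'a" where "z 0 = x" "z K = a"
    "\<And>k. dist (z k) (z (Suc k)) \<le> L * r * \<delta> * (1 - \<delta>) ^ k"
    "\<And>k. dist x (z k) \<le> L * r * (1 - (1 - \<delta>) ^ k)"
    "\<And>k. dist (z k) a \<le> L * r * (1 - \<delta>) ^ k"
proof -
  obtain Z where Z: "Z 0 = x" "Z (L * dist x a) = a"
    "\<And>s t. 0 \<le> s \<Longrightarrow> s \<le> t \<Longrightarrow> t \<le> L * dist x a \<Longrightarrow> dist (Z s) (Z t) \<le> t - s"
    using quasiconvex_Lipschitz_path[OF qc] by metis
  define q where "q = 1 - \<delta>"
  define l where "l = L * dist x a"
  \<comment> \<open>Truncation makes the chain rest at a once the path has ended, so the estimates
    hold for every k and not only up to K.\<close>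
  define s where "s k = min (L * r * (1 - q ^ k)) l" for k
  have q: "0 < q" "q < 1" using \<delta> by (auto simp: q_def)
  have qk: "0 < q ^ k" "q ^ k \<le> 1" for k
    using q by (auto simp: power_le_one)
  have Lr: "0 < L * r" using L r by simp
  have l0: "0 \<le> l" using L by (simp add: l_def)
  have l_le: "l \<le> L * r * (1 - q ^ K)"
    unfolding l_def using mult_left_mono[OF a, of L] L by (simp add: q_def mult.assoc)
  have s_in: "0 \<le> s k" "s k \<le> l" for k
    using qk[of k] Lr l0 by (auto simp: s_def min_def)
  have s_eq: "L * r * (1 - q ^ Suc k) = L * r * (1 - q ^ k) + L * r * \<delta> * q ^ k" for k
    by (simp add: q_def algebra_simps)
  have pos: "0 \<le> L * r * \<delta> * q ^ k" for k
    using Lr \<delta> qk[of k] by simp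
  have s_mono: "s k \<le> s (Suc k)" and s_step: "s (Suc k) - s k \<le> L * r * \<delta> * q ^ k" for k
    using pos[of k] by (auto simp: s_def s_eq min_def simp del: power_Suc)
  show ?thesis
  proof (rule that[of "\<lambda>k. Z (s k)"])
    have "s 0 = 0" using l0 by (simp add: s_def)
    then show "Z (s 0) = x" using Z by simp
    have "s K = l" using l_le by (simp add: s_def)
    then show "Z (s K) = a" using Z by (simp add: l_def)
  next
    fix k
    have "dist (Z (s k)) (Z (s (Suc k))) \<le> s (Suc k) - s k"
      using Z(3)[of "s k" "s (Suc k)"] s_in s_mono by (simp add: l_def)
    then show "dist (Z (s k)) (Z (s (Suc k))) \<le> L * r * \<delta> * (1 - \<delta>) ^ k"
      using s_step[of k] by (simp add: q_def)
    have "dist x (Z (s k)) \<le> s k"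
      using Z(3)[of 0 "s k"] Z(1) s_in by (simp add: l_def)
    also have "\<dots> \<le> L * r * (1 - q ^ k)" by (simp add: s_def)
    finally show "dist x (Z (s k)) \<le> L * r * (1 - (1 - \<delta>) ^ k)" by (simp add: q_def)
    have "dist (Z (s k)) a \<le> l - s k"
      using Z(3)[of "s k" l] Z(2) s_in by (simp add: l_def)
    also have "\<dots> \<le> L * r * q ^ k"
    proof -
      have "L * r * (1 - q ^ K) \<le> L * r"
        using qk[of K] Lr mult_left_mono[of "1 - q ^ K" 1 "L * r"] by simp
      moreover have "0 \<le> L * r * q ^ k" using Lr qk[of k] by simp
      ultimately show ?thesis
        using l_le by (auto simp: s_def min_def right_diff_distrib)
    qed
    finally show "dist (Z (s k)) a \<le> L * r * (1 - \<delta>) ^ k" by (simp add: q_def)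
  qed
qed

section \<open>Doubling measures and separated nets\<close>

text \<open>An inclusion of sigma-algebras instead of an equality leaves room for the completion of
  a Borel measure.\<close>

locale ball_finite_measure =
  fixes \<nu> :: "'a::metric_space measure"
  assumes space_UNIV: "space \<nu> = UNIV"
    and borel_sets: "sets borel \<subseteq> sets \<nu>"
    and emeasure_ball: "\<And>x r. 0 < r \<Longrightarrow> 0 < emeasure \<nu> (ball x r) \<and> emeasure \<nu> (ball x r) < \<infinity>"
begin

abbreviation vol :: "'a \<Rightarrow> real \<Rightarrow> real" where
  "vol x r \<equiv> measure \<nu> (ball x r)"

lemma fmeasurable_ball [simp, intro]: "ball x r \<in> fmeasurable \<nu>"
proof (cases "0 < r")
  case True
  then show ?thesis
    using borel_sets emeasure_ball[of r x] by (auto intro!: fmeasurableI)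
next
  case False
  then show ?thesis by (simp add: ball_empty)
qed

lemma sets_ball [simp, intro]: "ball x r \<in> sets \<nu>"
  using fmeasurable_ball by (rule fmeasurableD)

lemma vol_pos: "0 < r \<Longrightarrow> 0 < vol x r"
  using emeasure_ball[of r x] by (simp add: measure_def enn2real_positive_iff)

lemma vol_mono: "ball x r \<subseteq> ball y s \<Longrightarrow> vol x r \<le> vol y s"
  by (intro measure_mono_fmeasurable) auto

text \<open>Packing: balls of half the separation distance are pairwise disjoint, so their volumes
  add up inside the enclosing ball.\<close>

lemma sum_vol_separated_le:
  assumes "finite A" and sep: "\<And>a b. a \<in> A \<Longrightarrow> b \<in> A \<Longrightarrow> a \<noteq> b \<Longrightarrow> s \<le> dist a b"
    and sub: "\<And>a. a \<in> A \<Longrightarrow> ball a (s/2) \<subseteq> ball c R"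
  shows "(\<Sum>a\<in>A. vol a (s/2)) \<le> vol c R"
proof -
  have "disjoint_family_on (\<lambda>a. ball a (s/2)) A"
  proof (unfold disjoint_family_on_def, intro ballI impI)
    fix a b assume ab: "a \<in> A" "b \<in> A" "a \<noteq> b"
    have False if "dist a w < s/2" "dist b w < s/2" for w
      using sep[OF ab] that dist_triangle2[of a b w] by simp
    then show "ball a (s/2) \<inter> ball b (s/2) = {}"
      by auto
  qed
  then have "(\<Sum>a\<in>A. vol a (s/2)) = measure \<nu> (\<Union>a\<in>A. ball a (s/2))"
    using assms(1) fmeasurableD2[OF fmeasurable_ball]
    by (intro measure_finite_Union[symmetric]) auto
  also have "\<dots> \<le> vol c R"
    using sub assms(1) by (intro measure_mono_fmeasurable) auto
  finally show ?thesis .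
qed

text \<open>By packing, the lower volume bound \<open>e\<close> limits the cardinality of separated
  subsets of \<open>S\<close>. One of largest cardinality is a net, since a point far from all its
  members could be added.\<close>

lemma separated_net:
  assumes "0 < e" and lower: "\<And>a. a \<in> S \<Longrightarrow> e \<le> vol a (s/2)"
    and sub: "\<And>a. a \<in> S \<Longrightarrow> ball a (s/2) \<subseteq> ball c R" and "0 < s"
  obtains A where "finite A" "A \<subseteq> S" "\<And>a b. a \<in> A \<Longrightarrow> b \<in> A \<Longrightarrow> a \<noteq> b \<Longrightarrow> s \<le> dist a b"
    "\<And>y. y \<in> S \<Longrightarrow> \<exists>a\<in>A. dist a y < s"
proof -
  define P where "P A \<longleftrightarrow> finite A \<and> A \<subseteq> S \<and> (\<forall>a\<in>A. \<forall>b\<in>A. a \<noteq> b \<longrightarrow> s \<le> dist a b)" for A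
  have bound: "card A \<le> nat \<lceil>vol c R / e\<rceil>" if "P A" for A
  proof -
    have "real (card A) * e = (\<Sum>a\<in>A. e)" by simp
    also have "\<dots> \<le> (\<Sum>a\<in>A. vol a (s/2))"
      using that lower by (intro sum_mono) (auto simp: P_def)
    also have "\<dots> \<le> vol c R"
      using that sub by (intro sum_vol_separated_le) (auto simp: P_def)
    finally have "real (card A) \<le> vol c R / e"
      using \<open>0 < e\<close> by (simp add: field_simps)
    then show ?thesis
      by linarith
  qed
  have "P {}" by (simp add: P_def)
  then obtain A where A: "P A" and max: "\<And>B. P B \<Longrightarrow> card B \<le> card A"
    using ex_has_greatest_nat[of P "{}" card "Suc (nat \<lceil>vol c R / e\<rceil>)"] bound
    by (metis less_Suc_eq_le)
  show ?thesis
  proof (rule that[of A])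
    fix y assume y: "y \<in> S"
    show "\<exists>a\<in>A. dist a y < s"
    proof (rule ccontr)
      assume far: "\<not> (\<exists>a\<in>A. dist a y < s)"
      then have "y \<notin> A"
        using \<open>0 < s\<close> by force
      moreover have "P (insert y A)"
        using A y far by (auto simp: P_def dist_commute not_less)
      ultimately show False
        using max[of "insert y A"] A by (simp add: P_def)
    qed
  qed (use A in \<open>auto simp: P_def\<close>)
qed

section \<open>Doubling at all scales from quasiconvexity\<close>

definition vol_doubling :: "real \<Rightarrow> real \<Rightarrow> bool" where
  "vol_doubling R C \<longleftrightarrow> 1 \<le> C \<and> (\<forall>x r. 0 < r \<and> r \<le> R \<longrightarrow> vol x (2 * r) \<le> C * vol x r)"

lemma vol_doubling_upto:
  assumes "doubling_upto \<nu> R"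
  obtains C where "vol_doubling R C"
proof -
  obtain Cd where Cd: "\<And>x r. 0 < r \<Longrightarrow> r \<le> R \<Longrightarrow>
      emeasure \<nu> (ball x (2*r)) \<le> ennreal Cd * emeasure \<nu> (ball x r)"
    using assms unfolding doubling_upto_def by auto
  have "vol x (2 * r) \<le> max 1 Cd * vol x r" if "0 < r" "r \<le> R" for x r
  proof -
    have "ennreal (vol x (2 * r)) = emeasure \<nu> (ball x (2 * r))"
      by (simp add: emeasure_eq_measure2)
    also have "\<dots> \<le> ennreal Cd * emeasure \<nu> (ball x r)"
      using Cd that by blast
    also have "\<dots> \<le> ennreal (max 1 Cd) * ennreal (vol x r)"
      by (auto simp: emeasure_eq_measure2 intro!: mult_right_mono ennreal_leI)
    also have "\<dots> = ennreal (max 1 Cd * vol x r)"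
      by (simp add: ennreal_mult)
    finally show ?thesis
      by (simp add: ennreal_le_iff)
  qed
  then show ?thesis
    by (intro that[of "max 1 Cd"]) (auto simp: vol_doubling_def)
qed

text \<open>The limit is \<open>2 * R\<close> and not \<open>R\<close> because the last of n
  doublings starts from half of the final radius.\<close>

lemma vol_doubling_power:
  assumes D: "vol_doubling R C" and "0 < r" and "2 ^ n * r \<le> 2 * R"
  shows "vol x (2 ^ n * r) \<le> C ^ n * vol x r"
  using assms(3)
proof (induction n)
  case (Suc n)
  have "vol x (2 * (2 ^ n * r)) \<le> C * vol x (2 ^ n * r)"
    using D Suc.prems \<open>0 < r\<close> by (auto simp: vol_doubling_def)
  also have "\<dots> \<le> C * (C ^ n * vol x r)"
  proof (rule mult_left_mono)
    have "0 < 2 ^ n * r" using \<open>0 < r\<close> by simp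
    then show "vol x (2 ^ n * r) \<le> C ^ n * vol x r"
      using Suc.prems by (intro Suc.IH) simp
  qed (use D in \<open>simp add: vol_doubling_def\<close>)
  finally show ?case
    by (simp add: mult_ac)
qed simp

text \<open>The centres form a maximal \<rho>-separated subset of the doubled ball. The total volume
  of the cover is controlled, rather than the number of balls, so that the estimate can be iterated:
  one factor \<open>C\<close> passes from radius \<rho> to the disjoint balls of radius \<rho>/2,
  two more from the ball of radius 4\<rho> back to radius \<rho>.\<close>

lemma double_ball_cover:
  assumes D: "vol_doubling R C" and \<rho>: "0 < \<rho>" "2 * \<rho> \<le> R"
  shows "\<exists>F. finite F \<and> ball c (2 * \<rho>) \<subseteq> (\<Union>b\<in>F. ball b \<rho>) \<and> (\<Sum>b\<in>F. vol b \<rho>) \<le> C ^ 3 * vol c \<rho>"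
proof -
  have C: "1 \<le> C" using D by (simp add: vol_doubling_def)
  obtain F where F: "finite F" "F \<subseteq> ball c (2 * \<rho>)"
    "\<And>a b. a \<in> F \<Longrightarrow> b \<in> F \<Longrightarrow> a \<noteq> b \<Longrightarrow> \<rho> \<le> dist a b"
    "\<And>y. y \<in> ball c (2 * \<rho>) \<Longrightarrow> \<exists>a\<in>F. dist a y < \<rho>"
  proof (rule separated_net[where S = "ball c (2 * \<rho>)" and s = \<rho> and c = c and R = "4 * \<rho>"
        and e = "vol c (2 * \<rho>) / C ^ 3"])
    show "0 < vol c (2 * \<rho>) / C ^ 3"
      using \<rho> C vol_pos[of "2 * \<rho>"] by simp
    fix a assume a: "a \<in> ball c (2 * \<rho>)"
    have "ball c (2 * \<rho>) \<subseteq> ball a (2 ^ 3 * (\<rho> / 2))"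
    proof
      fix w assume "w \<in> ball c (2 * \<rho>)"
      then show "w \<in> ball a (2 ^ 3 * (\<rho> / 2))"
        using a dist_triangle[of a w c] by (simp add: dist_commute)
    qed
    then have "vol c (2 * \<rho>) \<le> vol a (2 ^ 3 * (\<rho> / 2))"
      by (rule vol_mono)
    also have "\<dots> \<le> C ^ 3 * vol a (\<rho> / 2)"
      using \<rho> by (intro vol_doubling_power[OF D]) auto
    finally show "vol c (2 * \<rho>) / C ^ 3 \<le> vol a (\<rho> / 2)"
      using C by (simp add: field_simps)
    show "ball a (\<rho> / 2) \<subseteq> ball c (4 * \<rho>)"
    proof
      fix w assume "w \<in> ball a (\<rho> / 2)"
      then show "w \<in> ball c (4 * \<rho>)"
        using a \<rho> dist_triangle[of c w a] by simp
    qed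
  qed (use \<rho> in auto)
  have "(\<Sum>b\<in>F. vol b \<rho>) \<le> (\<Sum>b\<in>F. C * vol b (\<rho> / 2))"
  proof (rule sum_mono)
    fix b
    show "vol b \<rho> \<le> C * vol b (\<rho> / 2)"
      using vol_doubling_power[OF D, of "\<rho> / 2" 1 b] \<rho> by simp
  qed
  also have "\<dots> = C * (\<Sum>b\<in>F. vol b (\<rho> / 2))"
    by (simp add: sum_distrib_left)
  also have "\<dots> \<le> C * vol c (4 * \<rho>)"
  proof (intro mult_left_mono sum_vol_separated_le)
    fix a assume "a \<in> F"
    then have a: "dist c a < 2 * \<rho>" using F(2) by auto
    show "ball a (\<rho> / 2) \<subseteq> ball c (4 * \<rho>)"
    proof
      fix w assume "w \<in> ball a (\<rho> / 2)"
      then show "w \<in> ball c (4 * \<rho>)"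
        using a \<rho> dist_triangle[of c w a] by simp
    qed
  qed (use F C in auto)
  also have "\<dots> \<le> C * (C ^ 2 * vol c \<rho>)"
    using vol_doubling_power[OF D, of \<rho> 2 c] \<rho> C by (intro mult_left_mono) auto
  also have "\<dots> = C ^ 3 * vol c \<rho>"
    by (simp add: power2_eq_square power3_eq_cube)
  finally show ?thesis
    using F by (intro exI[of _ F]) force
qed

text \<open>If c is within \<rho> of the n-th point of a chain, the next point is within 2\<rho> of
  c. Covering each doubled ball again costs a factor \<open>C ^ 3\<close> per step, and doubling is
  used only at scales up to \<open>R\<close>, however far the chain travels.\<close>

lemma chain_endpoints_cover:
  assumes D: "vol_doubling R C" and \<rho>: "0 < \<rho>" "2 * \<rho> \<le> R"
  shows "\<exists>F. finite F \<and>
    (\<forall>z. z 0 = x \<and> (\<forall>i<n. dist (z i) (z (Suc i)) \<le> \<rho>) \<longrightarrow> (\<exists>b\<in>F. dist b (z n) < \<rho>)) \<and>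
    (\<Sum>b\<in>F. vol b \<rho>) \<le> (C ^ 3) ^ n * vol x \<rho>"
proof (induction n)
  case 0
  show ?case
    using \<rho> by (intro exI[of _ "{x}"]) auto
next
  case (Suc n)
  then obtain F where F: "finite F"
    "\<And>z. z 0 = x \<Longrightarrow> (\<forall>i<n. dist (z i) (z (Suc i)) \<le> \<rho>) \<Longrightarrow> \<exists>b\<in>F. dist b (z n) < \<rho>"
    "(\<Sum>b\<in>F. vol b \<rho>) \<le> (C ^ 3) ^ n * vol x \<rho>"
    by blast
  obtain G where G: "\<And>c. finite (G c)" "\<And>c. ball c (2 * \<rho>) \<subseteq> (\<Union>b\<in>G c. ball b \<rho>)"
    "\<And>c. (\<Sum>b\<in>G c. vol b \<rho>) \<le> C ^ 3 * vol c \<rho>"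
    using double_ball_cover[OF D \<rho>] by metis
  \<comment> \<open>A centre may come from several doubled balls; counting it once only lowers the
    sum.\<close>
  have "(\<Sum>b\<in>snd ` Sigma F G. vol b \<rho>) \<le> (\<Sum>p\<in>Sigma F G. vol (snd p) \<rho>)"
    using sum_image_le[of "Sigma F G" "\<lambda>b. vol b \<rho>" snd] F(1) G(1) by (simp add: o_def)
  also have "\<dots> = (\<Sum>c\<in>F. \<Sum>b\<in>G c. vol b \<rho>)"
    using F(1) G(1) by (subst sum.Sigma) (auto simp: case_prod_beta)
  also have "\<dots> \<le> (\<Sum>c\<in>F. C ^ 3 * vol c \<rho>)"
    by (intro sum_mono G)
  also have "\<dots> = C ^ 3 * (\<Sum>c\<in>F. vol c \<rho>)"
    by (simp add: sum_distrib_left)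
  also have "\<dots> \<le> C ^ 3 * ((C ^ 3) ^ n * vol x \<rho>)"
    using F(3) D by (intro mult_left_mono) (auto simp: vol_doubling_def)
  finally have le: "(\<Sum>b\<in>snd ` Sigma F G. vol b \<rho>) \<le> (C ^ 3) ^ Suc n * vol x \<rho>"
    by (simp add: mult_ac)
  have "\<exists>b\<in>snd ` Sigma F G. dist b (z (Suc n)) < \<rho>"
    if z: "z 0 = x" "\<forall>i<Suc n. dist (z i) (z (Suc i)) \<le> \<rho>" for z
  proof -
    obtain c where c: "c \<in> F" "dist c (z n) < \<rho>"
      using F(2)[of z] z by auto
    moreover have "dist (z n) (z (Suc n)) \<le> \<rho>"
      using z by blast
    ultimately have "z (Suc n) \<in> ball c (2 * \<rho>)"
      using dist_triangle[of c "z (Suc n)" "z n"] by simp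
    then obtain b where "b \<in> G c" "dist b (z (Suc n)) < \<rho>"
      using G(2)[of c] by auto
    with c show ?thesis
      by force
  qed
  with le F(1) G(1) show ?case
    by (intro exI[of _ "snd ` Sigma F G"]) auto
qed

text \<open>By quasiconvexity every point of B(x,M) is the end of a chain from x with steps at most
  R/2, and the number of steps depends only on L, M and R. Hence the constant is uniform in
  x.\<close>

lemma vol_large_ball:
  assumes qc: "quasiconvex L (UNIV :: 'a set)" and L: "1 \<le> L"
    and D: "vol_doubling R C" and "0 < R" "0 < M"
  shows "\<exists>C'\<ge>1. \<forall>x. vol x M \<le> C' * vol x R"
proof -
  define \<rho> where "\<rho> = R / 2"
  have \<rho>: "0 < \<rho>" "2 * \<rho> \<le> R" using \<open>0 < R\<close> by (auto simp: \<rho>_def)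
  define n where "n = nat \<lceil>L * M / \<rho>\<rceil>"
  have n: "L * M \<le> real n * \<rho>"
  proof -
    have "L * M / \<rho> \<le> real n" unfolding n_def by linarith
    then show ?thesis using \<rho> by (simp add: field_simps)
  qed
  have "vol x M \<le> (C ^ 3) ^ n * vol x R" for x
  proof -
    obtain F where F: "finite F"
      "\<And>z. z 0 = x \<Longrightarrow> (\<forall>i<n. dist (z i) (z (Suc i)) \<le> \<rho>) \<Longrightarrow> \<exists>b\<in>F. dist b (z n) < \<rho>"
      "(\<Sum>b\<in>F. vol b \<rho>) \<le> (C ^ 3) ^ n * vol x \<rho>"
      using chain_endpoints_cover[OF D \<rho>, of x n] by blast
    have "ball x M \<subseteq> (\<Union>b\<in>F. ball b \<rho>)"
    proof
      fix y assume "y \<in> ball x M"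
      then have y: "dist x y < M" by simp
      obtain Z where Z: "Z 0 = x" "Z (L * dist x y) = y"
        "\<And>s t. 0 \<le> s \<Longrightarrow> s \<le> t \<Longrightarrow> t \<le> L * dist x y \<Longrightarrow> dist (Z s) (Z t) \<le> t - s"
        using quasiconvex_Lipschitz_path[OF qc] by metis
      define l where "l = L * dist x y"
      have l: "0 \<le> l" "l \<le> real n * \<rho>"
        using L y n mult_left_mono[of "dist x y" M L] unfolding l_def by (simp, linarith)
      have "dist (Z (min (real i * \<rho>) l)) (Z (min (real (Suc i) * \<rho>) l)) \<le> \<rho>" for i
      proof -
        have "dist (Z (min (real i * \<rho>) l)) (Z (min (real (Suc i) * \<rho>) l))
            \<le> min (real (Suc i) * \<rho>) l - min (real i * \<rho>) l"
          using \<rho> l by (intro Z(3)) (auto simp: l_def min_def algebra_simps)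
        also have "\<dots> \<le> \<rho>"
          using \<rho> by (auto simp: min_def algebra_simps)
        finally show ?thesis .
      qed
      moreover have "Z (min (real 0 * \<rho>) l) = x" "Z (min (real n * \<rho>) l) = y"
        using Z l by (auto simp: l_def min_def)
      ultimately show "y \<in> (\<Union>b\<in>F. ball b \<rho>)"
        using F(2)[of "\<lambda>i. Z (min (real i * \<rho>) l)"] by auto
    qed
    then have "vol x M \<le> measure \<nu> (\<Union>b\<in>F. ball b \<rho>)"
      using F(1) by (intro measure_mono_fmeasurable) auto
    also have "\<dots> \<le> (\<Sum>b\<in>F. vol b \<rho>)"
      using F(1) by (intro measure_UNION_le) auto
    also have "\<dots> \<le> (C ^ 3) ^ n * vol x R"
    proof -
      have "vol x \<rho> \<le> vol x R"
        using \<rho> by (intro vol_mono) auto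
      then have "(C ^ 3) ^ n * vol x \<rho> \<le> (C ^ 3) ^ n * vol x R"
        using D by (intro mult_left_mono) (auto simp: vol_doubling_def)
      with F(3) show ?thesis by simp
    qed
    finally show ?thesis .
  qed
  moreover have "1 \<le> (C ^ 3) ^ n"
    using D by (intro one_le_power) (simp add: vol_doubling_def)
  ultimately show ?thesis by blast
qed

text \<open>This collects all volume comparisons needed later. It follows from doubling up to a
  scale S beyond \<open>R0\<close>, since B(w,M\<rho>) lies in B(z,2M\<rho>) and 2M\<rho> is less
  than 2^n times \<rho>/2.\<close>

lemma vol_comparable:
  assumes qc: "quasiconvex L (UNIV :: 'a set)" and L: "1 \<le> L"
    and D: "vol_doubling R0 C" and "0 < R0" "0 < R" "1 \<le> M"
  shows "\<exists>C'\<ge>1. \<forall>w z \<rho>. 0 < \<rho> \<and> \<rho> \<le> R \<and> dist w z \<le> M * \<rho> \<longrightarrow> vol w (M * \<rho>) \<le> C' * vol z (\<rho> / 2)"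
proof -
  obtain n where n: "4 * M < 2 ^ n"
    using real_arch_pow[of 2 "4 * M"] by auto
  define S where "S = 2 ^ n * R"
  have S: "0 < S" using \<open>0 < R\<close> by (simp add: S_def)
  obtain C1 where C1: "1 \<le> C1" "\<And>x. vol x (2 * S) \<le> C1 * vol x R0"
    using vol_large_ball[OF qc L D, of "2 * S"] S \<open>0 < R0\<close> by auto
  define C2 where "C2 = C + C1"
  have C: "1 \<le> C" using D by (simp add: vol_doubling_def)
  \<comment> \<open>Up to \<open>R0\<close> the given constant applies. For larger r the ball of
    radius 2S is comparable to the concentric one of radius \<open>R0\<close>, which lies inside
    B(x,r).\<close>
  have D2: "vol_doubling S C2"
    unfolding vol_doubling_def
  proof (intro conjI allI impI; (elim conjE)?)
    show "1 \<le> C2" using C C1 by (simp add: C2_def)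
    fix x r assume r: "0 < r" "r \<le> S"
    show "vol x (2 * r) \<le> C2 * vol x r"
    proof (cases "r \<le> R0")
      case True
      then have "vol x (2 * r) \<le> C * vol x r"
        using D r by (auto simp: vol_doubling_def)
      also have "\<dots> \<le> C2 * vol x r"
        using C1 by (intro mult_right_mono) (auto simp: C2_def)
      finally show ?thesis .
    next
      case False
      have "vol x (2 * r) \<le> vol x (2 * S)"
        using r by (intro vol_mono) auto
      also have "\<dots> \<le> C1 * vol x R0" by (rule C1)
      also have "\<dots> \<le> C2 * vol x r"
        using C C1 False by (intro mult_mono vol_mono) (auto simp: C2_def)
      finally show ?thesis .
    qed
  qed
  have "vol w (M * \<rho>) \<le> C2 ^ n * vol z (\<rho> / 2)" if \<rho>: "0 < \<rho>" "\<rho> \<le> R" "dist w z \<le> M * \<rho>" for w z \<rho>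
  proof -
    have "ball w (M * \<rho>) \<subseteq> ball z (2 ^ n * (\<rho> / 2))"
    proof
      fix v assume "v \<in> ball w (M * \<rho>)"
      then have "dist z v < 2 * M * \<rho>"
        using \<rho> dist_triangle[of z v w] by (simp add: dist_commute)
      also have "\<dots> \<le> 2 ^ n * (\<rho> / 2)"
        using mult_right_mono[of "4 * M" "2 ^ n" "\<rho> / 2"] n \<rho> by simp
      finally show "v \<in> ball z (2 ^ n * (\<rho> / 2))" by simp
    qed
    then have "vol w (M * \<rho>) \<le> vol z (2 ^ n * (\<rho> / 2))"
      by (rule vol_mono)
    also have "\<dots> \<le> C2 ^ n * vol z (\<rho> / 2)"
    proof (rule vol_doubling_power[OF D2])
      have "2 ^ n * \<rho> \<le> 2 ^ n * R" using \<rho> by simp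
      then show "2 ^ n * (\<rho> / 2) \<le> 2 * S" using S unfolding S_def by linarith
    qed (use \<rho> in simp)
    finally show ?thesis .
  qed
  moreover have "1 \<le> C2 ^ n"
    using D2 by (intro one_le_power) (simp add: vol_doubling_def)
  ultimately show ?thesis by blast
qed

end

section \<open>Mean oscillation along chains\<close>

text \<open>Integrating the pointwise bound on the weighted number of overlaps exchanges the sum
  over net points with the integral over w.\<close>

lemma sum_measure_le_overlap:
  assumes "finite_measure m" "finite A" and S: "\<And>a. a \<in> A \<Longrightarrow> S a \<in> sets m"
    and overlap: "\<And>w. (\<Sum>a | a \<in> A \<and> w \<in> S a. c a) \<le> (C::real)"
  shows "(\<Sum>a\<in>A. c a * measure m (S a)) \<le> C * measure m (space m)"
proof -
  interpret finite_measure m by fact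
  have int: "integrable m (\<lambda>w. c a * indicator (S a) w)" if "a \<in> A" for a
    using S[OF that] by (intro integrable_mult_right integrable_real_indicator) (auto simp: less_top[symmetric])
  have "(\<Sum>a\<in>A. c a * measure m (S a)) = (\<Sum>a\<in>A. LINT w|m. c a * indicator (S a) w)"
    using S by (intro sum.cong) auto
  also have "\<dots> = (LINT w|m. (\<Sum>a\<in>A. c a * indicator (S a) w))"
    by (rule Bochner_Integration.integral_sum[symmetric]) (rule int)
  also have "\<dots> \<le> (LINT w|m. C)"
  proof (rule integral_mono)
    show "integrable m (\<lambda>w. \<Sum>a\<in>A. c a * indicator (S a) w)"
      by (intro Bochner_Integration.integrable_sum int)
    fix w
    have "(\<Sum>a\<in>A. c a * indicator (S a) w) = (\<Sum>a | a \<in> A \<and> w \<in> S a. c a)"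
      using \<open>finite A\<close> by (intro sum.mono_neutral_cong_right) auto
    with overlap show "(\<Sum>a\<in>A. c a * indicator (S a) w) \<le> C" by simp
  qed simp
  finally show ?thesis by (simp add: mult.commute)
qed

locale bounded_function = ball_finite_measure +
  fixes u :: "'a \<Rightarrow> real"
  assumes u_measurable [measurable]: "u \<in> borel_measurable \<nu>"
    and u_bounded: "bounded (range u)"
begin

text \<open>The deviation is not normalised, so that it is monotone in the set and subadditive over
  covers.\<close>

abbreviation dev :: "'a set \<Rightarrow> real \<Rightarrow> real" where
  "dev S c \<equiv> (LINT y:S|\<nu>. \<bar>u y - c\<bar>)"

lemma u_integrable: "S \<in> fmeasurable \<nu> \<Longrightarrow> set_integrable \<nu> S u"
proof -
  assume S: "S \<in> fmeasurable \<nu>"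
  obtain b where b: "\<And>y. \<bar>u y\<bar> \<le> b"
    using u_bounded unfolding bounded_iff by auto
  show ?thesis
    unfolding set_integrable_def
    using S b by (intro integrableI_bounded_set_indicator[where B = b]) (auto simp: fmeasurable_def)
qed

lemma const_integrable: "S \<in> fmeasurable \<nu> \<Longrightarrow> set_integrable \<nu> S (\<lambda>_. c :: real)"
  unfolding set_integrable_def
  by (intro integrableI_bounded_set_indicator[where B = "\<bar>c\<bar>"]) (auto simp: fmeasurable_def)

lemma dev_integrable: "S \<in> fmeasurable \<nu> \<Longrightarrow> set_integrable \<nu> S (\<lambda>y. \<bar>u y - c\<bar>)"
  by (intro set_integrable_abs set_integral_diff u_integrable const_integrable)

lemma dev_cover:
  assumes "finite A" "S \<in> fmeasurable \<nu>" "\<And>a. a \<in> A \<Longrightarrow> B a \<in> fmeasurable \<nu>" "S \<subseteq> (\<Union>a\<in>A. B a)"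
  shows "dev S c \<le> (\<Sum>a\<in>A. dev (B a) c)"
proof -
  have "dev S c \<le> (LINT y|\<nu>. (\<Sum>a\<in>A. indicator (B a) y *\<^sub>R \<bar>u y - c\<bar>))"
    unfolding set_lebesgue_integral_def
  proof (rule integral_mono)
    show "integrable \<nu> (\<lambda>y. indicator S y *\<^sub>R \<bar>u y - c\<bar>)"
      using dev_integrable[OF assms(2)] by (simp add: set_integrable_def)
    show "integrable \<nu> (\<lambda>y. \<Sum>a\<in>A. indicator (B a) y *\<^sub>R \<bar>u y - c\<bar>)"
      using dev_integrable[OF assms(3)]
      by (intro Bochner_Integration.integrable_sum) (simp add: set_integrable_def)
    fix y
    show "indicator S y *\<^sub>R \<bar>u y - c\<bar> \<le> (\<Sum>a\<in>A. indicator (B a) y *\<^sub>R \<bar>u y - c\<bar>)"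
    proof (cases "y \<in> S")
      case True
      then obtain a where a: "a \<in> A" "y \<in> B a" using assms(4) by auto
      have "indicator S y *\<^sub>R \<bar>u y - c\<bar> = indicator (B a) y *\<^sub>R \<bar>u y - c\<bar>"
        using a True by simp
      also have "\<dots> \<le> (\<Sum>a\<in>A. indicator (B a) y *\<^sub>R \<bar>u y - c\<bar>)"
        using a assms(1) by (intro member_le_sum) auto
      finally show ?thesis .
    qed (auto intro!: sum_nonneg)
  qed
  also have "\<dots> = (\<Sum>a\<in>A. dev (B a) c)"
    unfolding set_lebesgue_integral_def
    using dev_integrable[OF assms(3)]
    by (intro Bochner_Integration.integral_sum) (simp add: set_integrable_def)
  finally show ?thesis .
qed

lemma dev_mono: "S \<in> fmeasurable \<nu> \<Longrightarrow> T \<in> fmeasurable \<nu> \<Longrightarrow> S \<subseteq> T \<Longrightarrow> dev S c \<le> dev T c"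
  using dev_cover[of "{()}" S "\<lambda>_. T" c] by simp

text \<open>This compares the averages over two consecutive chain balls with a single constant, when
  \<open>T\<close> is a ball containing both.\<close>

lemma avg_minus_const_le:
  assumes "S \<in> fmeasurable \<nu>" "T \<in> fmeasurable \<nu>" "S \<subseteq> T" "0 < measure \<nu> S"
  shows "\<bar>avg \<nu> S u - c\<bar> \<le> dev T c / measure \<nu> S"
proof -
  have int: "set_integrable \<nu> S (\<lambda>y. u y - c)"
    using assms by (intro set_integral_diff u_integrable const_integrable)
  have "(LINT y:S|\<nu>. u y - c) = (LINT y:S|\<nu>. u y) - c * measure \<nu> S"
    using assms u_integrable const_integrable[of S c]
    by (subst set_integral_diff) (auto simp: set_integral_const fmeasurable_def)
  then have eq: "avg \<nu> S u - c = (LINT y:S|\<nu>. u y - c) / measure \<nu> S"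
    using assms(4) by (simp add: avg_def field_simps)
  have "\<bar>LINT y:S|\<nu>. u y - c\<bar> \<le> dev S c"
    using integral_abs_bound[of \<nu> "\<lambda>y. indicator S y *\<^sub>R (u y - c)"]
    by (simp add: set_lebesgue_integral_def abs_mult)
  also have "\<dots> \<le> dev T c"
    using assms by (intro dev_mono)
  finally show ?thesis
    using assms(4) by (simp add: eq divide_right_mono)
qed

lemma dev_shift:
  assumes "S \<in> fmeasurable \<nu>"
  shows "dev S c \<le> dev S d + measure \<nu> S * \<bar>d - c\<bar>"
proof -
  have "dev S c \<le> (LINT y:S|\<nu>. \<bar>u y - d\<bar> + \<bar>d - c\<bar>)"
    using assms by (intro set_integral_mono set_integral_add dev_integrable const_integrable) auto
  also have "\<dots> = dev S d + measure \<nu> S * \<bar>d - c\<bar>"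
    using assms dev_integrable[of S d] const_integrable[of S "\<bar>d - c\<bar>"]
    by (subst set_integral_add) (auto simp: set_integral_const fmeasurable_def)
  finally show ?thesis .
qed

text \<open>The mean is optimal up to a factor 2, so oscillation may be measured from the average
  over a different ball.\<close>

lemma dev_avg_le:
  assumes "S \<in> fmeasurable \<nu>" "0 < measure \<nu> S"
  shows "dev S (avg \<nu> S u) \<le> 2 * dev S c"
proof -
  have "\<bar>avg \<nu> S u - c\<bar> \<le> dev S c / measure \<nu> S"
    using assms by (intro avg_minus_const_le) auto
  then have "measure \<nu> S * \<bar>c - avg \<nu> S u\<bar> \<le> dev S c"
    using assms(2) by (simp add: field_simps abs_minus_commute)
  then show ?thesis
    using dev_shift[OF assms(1), of "avg \<nu> S u" c] by simp
qed

section \<open>The chaining estimate, uniform in the number of steps\<close>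

text \<open>\<open>PI\<close> is the linearised Poincare inequality and \<open>m\<close> the measure
  on its right-hand side. Each net ball contributes its own oscillation and its volume times the
  telescoped differences of averages along its chain. Of the factors \<open>C ^ 3\<close>, one comes
  from a telescoping step and two from the overlap of the chain balls.\<close>

lemma chain_dev_estimate:
  fixes m :: "'a measure"
  assumes qc: "quasiconvex L (UNIV :: 'a set)" and L: "1 \<le> L" and lam: "1 \<le> lam"
    and \<delta>: "0 < \<delta>" "2 * lam * \<delta> \<le> 1" and r: "0 < r" and C: "1 \<le> C" and \<kappa>: "0 \<le> \<kappa>"
    and comp: "\<And>w z \<rho>. 0 < \<rho> \<Longrightarrow> \<rho> \<le> L * r * \<delta> \<Longrightarrow> dist w z \<le> 3 / \<delta> * \<rho> \<Longrightarrow>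
      vol w (3 / \<delta> * \<rho>) \<le> C * vol z (\<rho> / 2)"
    and lower: "\<And>s. 0 < s \<Longrightarrow> \<exists>e>0. \<forall>a\<in>ball x r. e \<le> vol a s"
    and m: "finite_measure m" "sets m = sets \<nu>"
    and PI: "\<And>z s. 0 < s \<Longrightarrow> s \<le> 2 * (L * r * \<delta>) \<Longrightarrow> ball z (lam * s) \<subseteq> ball x (L * r) \<Longrightarrow>
      dev (ball z s) (avg \<nu> (ball z s) u) \<le> \<kappa> * s * measure m (ball z (lam * s))"
  shows "dev (cball x (r * (1 - (1 - \<delta>) ^ K))) (avg \<nu> (ball x (L * r * \<delta>)) u)
    \<le> 5 * C ^ 3 * L * \<kappa> * r * measure m UNIV"
proof -
  define q where "q = 1 - \<delta>"
  define \<rho> where "\<rho> k = L * r * \<delta> * q ^ k" for k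
  define E where "E = cball x (r * (1 - q ^ K))"
  have "\<delta> \<le> 1 / 2"
  proof -
    have "1 * \<delta> \<le> lam * \<delta>" using lam \<delta> by (intro mult_right_mono) auto
    moreover have "2 * (lam * \<delta>) \<le> 1" using \<delta> by (simp add: mult.assoc)
    ultimately show ?thesis by linarith
  qed
  then have q: "1 / 2 \<le> q" "q < 1" "0 < q" using \<delta> by (auto simp: q_def)
  have qk: "0 < q ^ k" "q ^ k \<le> 1" for k
    using q by (auto simp: power_le_one)
  have Lr: "0 < L * r" using L r by simp
  have \<rho>0: "0 < \<rho> k" and \<rho>_le: "\<rho> k \<le> L * r * \<delta>" for k
    using Lr \<delta> qk[of k] mult_left_mono[of "q ^ k" 1 "L * r * \<delta>"] by (auto simp: \<rho>_def)
  have \<rho>_Suc: "\<rho> (Suc k) = q * \<rho> k" for k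
    by (simp add: \<rho>_def)
  have \<rho>_mono: "\<rho> j \<le> \<rho> k" if "k \<le> j" for j k
    using Lr \<delta> q that by (auto simp: \<rho>_def intro!: mult_left_mono power_decreasing)
  have \<rho>_div: "1 / \<delta> * \<rho> k = L * r * q ^ k" for k
    using \<delta> by (simp add: \<rho>_def)
  have \<rho>_le_div: "\<rho> k \<le> 1 / \<delta> * \<rho> k" "2 * lam * \<rho> k \<le> 1 / \<delta> * \<rho> k" for k
    using \<delta> \<rho>0[of k] \<open>\<delta> \<le> 1 / 2\<close> mult_right_mono[OF \<delta>(2), of "\<rho> k"]
    by (auto simp: field_simps)
  have E_sub: "E \<subseteq> ball x r"
  proof
    fix y assume "y \<in> E"
    then have "dist x y \<le> r * (1 - q ^ K)" by (simp add: E_def)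
    also have "\<dots> < r * 1" using r qk[of K] by (intro mult_strict_left_mono) auto
    finally show "y \<in> ball x r" by simp
  qed
  have E_meas: "E \<in> fmeasurable \<nu>"
    using fmeasurable_ball E_sub
  proof (rule fmeasurableI2)
    show "E \<in> sets \<nu>" using borel_sets by (auto simp: E_def)
  qed
  obtain e where e: "0 < e" "\<And>a. a \<in> ball x r \<Longrightarrow> e \<le> vol a (\<rho> K / 2)"
    using lower[of "\<rho> K / 2"] \<rho>0[of K] by auto
  obtain A where A: "finite A" "A \<subseteq> E"
    and sep: "\<And>a b. a \<in> A \<Longrightarrow> b \<in> A \<Longrightarrow> a \<noteq> b \<Longrightarrow> \<rho> K \<le> dist a b"
    and net: "\<And>y. y \<in> E \<Longrightarrow> \<exists>a\<in>A. dist a y < \<rho> K"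
  proof (rule separated_net[where S = E and s = "\<rho> K" and e = e and c = x and R = "r + \<rho> K"])
    fix a assume a: "a \<in> E"
    then show "e \<le> vol a (\<rho> K / 2)" using e E_sub by auto
    show "ball a (\<rho> K / 2) \<subseteq> ball x (r + \<rho> K)"
    proof
      fix w assume "w \<in> ball a (\<rho> K / 2)"
      moreover have "dist x a < r" using a E_sub by auto
      ultimately show "w \<in> ball x (r + \<rho> K)"
        using \<rho>0[of K] dist_triangle[of x w a] by simp
    qed
  qed (use e \<rho>0 in auto)
  have "\<forall>a\<in>A. \<exists>z :: nat \<Rightarrow> 'a. z 0 = x \<and> z K = a \<and> (\<forall>k. dist (z k) (z (Suc k)) \<le> \<rho> k) \<and>
    (\<forall>k. dist x (z k) \<le> L * r * (1 - q ^ k)) \<and> (\<forall>k. dist (z k) a \<le> L * r * q ^ k)"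
  proof
    fix a assume "a \<in> A"
    then have "dist x a \<le> r * (1 - (1 - \<delta>) ^ K)"
      using A by (auto simp: E_def q_def)
    moreover have "\<delta> < 1" using \<open>\<delta> \<le> 1 / 2\<close> by simp
    ultimately show "\<exists>z :: nat \<Rightarrow> 'a. z 0 = x \<and> z K = a \<and> (\<forall>k. dist (z k) (z (Suc k)) \<le> \<rho> k) \<and>
      (\<forall>k. dist x (z k) \<le> L * r * (1 - q ^ k)) \<and> (\<forall>k. dist (z k) a \<le> L * r * q ^ k)"
      using quasiconvex_chain[OF qc L \<delta>(1) _ r] unfolding \<rho>_def q_def by metis
  qed
  then obtain z where z: "\<And>a. a \<in> A \<Longrightarrow> z a 0 = x" "\<And>a. a \<in> A \<Longrightarrow> z a K = a"
    and z_step: "\<And>a k. a \<in> A \<Longrightarrow> dist (z a k) (z a (Suc k)) \<le> \<rho> k"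
    and z_x: "\<And>a k. a \<in> A \<Longrightarrow> dist x (z a k) \<le> L * r * (1 - q ^ k)"
    and z_a: "\<And>a k. a \<in> A \<Longrightarrow> dist (z a k) a \<le> 1 / \<delta> * \<rho> k"
    unfolding \<rho>_div by metis
  \<comment> \<open>The centre is at distance at most L r (1 - q^k) from x, and
    \<open>2 * lam * \<delta> \<le> 1\<close> bounds the dilated radius by the remainder L r
    q^k.\<close>
  have inside: "ball (z a k) (lam * s) \<subseteq> ball x (L * r)" if "a \<in> A" "s \<le> 2 * \<rho> k" for a k s
  proof
    fix w assume "w \<in> ball (z a k) (lam * s)"
    then have "dist (z a k) w < lam * s" by simp
    also have "\<dots> \<le> lam * (2 * \<rho> k)" using that lam by (intro mult_left_mono) auto
    also have "\<dots> \<le> L * r * q ^ k" using \<rho>_le_div(2)[of k] \<rho>_div by simp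
    finally have "dist (z a k) w < L * r * q ^ k" .
    then show "w \<in> ball x (L * r)"
      using z_x[OF that(1), of k] dist_triangle[of x w "z a k"] by (simp add: algebra_simps)
  qed
  define mU where "mU = measure m UNIV"
  have mU: "0 \<le> mU" by (simp add: mU_def)
  have "space m = UNIV"
    using m(2) space_UNIV sets_eq_imp_space_eq by blast
  have sets_m: "ball w s \<in> sets m" for w s
    using m(2) by simp
  \<comment> \<open>This controls the shadow of w at level k. Since \<rho>_K \<le> \<rho>_k \<le>
    \<rho>_k/\<delta>, enlarging the distance 2\<rho>_k/\<delta> by \<rho>_K/2 stays within
    3\<rho>_k/\<delta>, the radius used in \<open>comp\<close>.\<close>
  have overlap: "(\<Sum>a\<in>T. vol a (\<rho> K / 2)) \<le> vol w (3 / \<delta> * \<rho> k)"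
    if "k \<le> K" "T \<subseteq> A" "\<And>a. a \<in> T \<Longrightarrow> dist w a \<le> 2 / \<delta> * \<rho> k" for T w k
  proof (rule sum_vol_separated_le)
    show "finite T" using that A finite_subset by blast
    show "\<rho> K \<le> dist a b" if "a \<in> T" "b \<in> T" "a \<noteq> b" for a b
      using sep that \<open>T \<subseteq> A\<close> by auto
    fix a assume "a \<in> T"
    show "ball a (\<rho> K / 2) \<subseteq> ball w (3 / \<delta> * \<rho> k)"
    proof
      fix v assume "v \<in> ball a (\<rho> K / 2)"
      then have "dist w v < 2 / \<delta> * \<rho> k + \<rho> K / 2"
        using that(3)[OF \<open>a \<in> T\<close>] dist_triangle[of w v a] by simp
      also have "\<dots> \<le> 2 / \<delta> * \<rho> k + 1 / \<delta> * \<rho> k"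
        using \<rho>_mono[OF that(1)] \<rho>0[of K] \<rho>_le_div(1)[of k] by simp
      also have "\<dots> = 3 / \<delta> * \<rho> k" by (simp add: field_simps)
      finally show "v \<in> ball w (3 / \<delta> * \<rho> k)" by simp
    qed
  qed
  have vol_M_pos: "0 < vol w (3 / \<delta> * \<rho> k)" for w k
    using \<rho>0[of k] \<delta> by (intro vol_pos) simp
  have near_M: "2 / \<delta> * \<rho> k \<le> 3 / \<delta> * \<rho> k" "1 / \<delta> * \<rho> k \<le> 2 / \<delta> * \<rho> k" for k
    using \<rho>0[of k] \<delta> by (auto intro!: mult_right_mono divide_right_mono)
  \<comment> \<open>At the last level the weights are 1, so the overlap is a count: each net point
    in the shadow takes at least the fraction 1/C of the volume of the enclosing ball.\<close>
  have sum_last: "(\<Sum>a\<in>A. 1 * measure m (ball a (lam * \<rho> K))) \<le> C * mU"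
    unfolding mU_def \<open>space m = UNIV\<close>[symmetric]
  proof (rule sum_measure_le_overlap[OF m(1) A(1) sets_m])
    fix w
    define T where "T = {a \<in> A. w \<in> ball a (lam * \<rho> K)}"
    have near: "dist w a \<le> 2 / \<delta> * \<rho> K" if "a \<in> T" for a
    proof -
      have "dist w a \<le> lam * \<rho> K" using that by (simp add: T_def dist_commute)
      also have "\<dots> \<le> 2 * lam * \<rho> K" using \<rho>0[of K] lam by simp
      finally show ?thesis using \<rho>_le_div(2)[of K] near_M(2)[of K] by simp
    qed
    have "real (card T) * vol w (3 / \<delta> * \<rho> K) = (\<Sum>a\<in>T. vol w (3 / \<delta> * \<rho> K))" by simp
    also have "\<dots> \<le> (\<Sum>a\<in>T. C * vol a (\<rho> K / 2))"
      using near near_M(1)[of K] \<rho>0 \<rho>_le by (intro sum_mono comp) (auto intro: order_trans)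
    also have "\<dots> = C * (\<Sum>a\<in>T. vol a (\<rho> K / 2))" by (simp add: sum_distrib_left)
    also have "\<dots> \<le> C * vol w (3 / \<delta> * \<rho> K)"
      using C near by (intro mult_left_mono overlap) (auto simp: T_def)
    finally have "real (card T) \<le> C" using vol_M_pos[of w K] by simp
    then show "(\<Sum>a | a \<in> A \<and> w \<in> ball a (lam * \<rho> K). 1) \<le> C"
      by (simp add: T_def)
  qed
  \<comment> \<open>Chain balls of many net points may coincide, so a count would not be bounded.
    The weights compensate: one factor \<open>C\<close> passes from radius \<rho>_K to the disjoint
    balls of radius \<rho>_K/2, the other replaces the chain ball by a ball about w that contains
    all of these.\<close>
  have sum_level: "(\<Sum>a\<in>A. vol a (\<rho> K) / vol (z a k) (\<rho> k) * measure m (ball (z a k) (lam * (2 * \<rho> k))))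
      \<le> C ^ 2 * mU" if "k \<le> K" for k
    unfolding mU_def \<open>space m = UNIV\<close>[symmetric]
  proof (rule sum_measure_le_overlap[OF m(1) A(1) sets_m])
    fix w
    define T where "T = {a \<in> A. w \<in> ball (z a k) (lam * (2 * \<rho> k))}"
    have zw: "dist w (z a k) \<le> 1 / \<delta> * \<rho> k" if "a \<in> T" for a
      using that \<rho>_le_div(2)[of k] by (simp add: T_def dist_commute)
    have near: "dist w a \<le> 2 / \<delta> * \<rho> k" if "a \<in> T" for a
      using zw[OF that] z_a[of a k] that dist_triangle[of w a "z a k"] by (simp add: T_def)
    have "(\<Sum>a\<in>T. vol a (\<rho> K) / vol (z a k) (\<rho> k))
        \<le> (\<Sum>a\<in>T. (C ^ 2 / vol w (3 / \<delta> * \<rho> k)) * vol a (\<rho> K / 2))"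
    proof (rule sum_mono)
      fix a assume "a \<in> T"
      have "vol a (\<rho> K) \<le> vol a (3 / \<delta> * \<rho> K)"
        using \<rho>_le_div(1)[of K] near_M[of K] by (intro vol_mono) auto
      also have "\<dots> \<le> C * vol a (\<rho> K / 2)"
        using \<rho>0[of K] \<rho>_le[of K] \<delta> by (intro comp) auto
      finally have 1: "vol a (\<rho> K) \<le> C * vol a (\<rho> K / 2)" .
      have "vol w (3 / \<delta> * \<rho> k) \<le> C * vol (z a k) (\<rho> k / 2)"
        using \<rho>0[of k] \<rho>_le[of k] zw[OF \<open>a \<in> T\<close>] near_M[of k] by (intro comp) auto
      also have "\<dots> \<le> C * vol (z a k) (\<rho> k)"
        using C \<rho>0[of k] by (intro mult_left_mono vol_mono) auto
      finally have 2: "vol w (3 / \<delta> * \<rho> k) \<le> C * vol (z a k) (\<rho> k)" .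
      have "vol a (\<rho> K) * vol w (3 / \<delta> * \<rho> k) \<le> (C * vol a (\<rho> K / 2)) * (C * vol (z a k) (\<rho> k))"
        using 1 2 C by (intro mult_mono) auto
      then show "vol a (\<rho> K) / vol (z a k) (\<rho> k) \<le> (C ^ 2 / vol w (3 / \<delta> * \<rho> k)) * vol a (\<rho> K / 2)"
        using vol_M_pos[of w k] vol_pos[OF \<rho>0[of k], of "z a k"]
        by (simp add: field_simps power2_eq_square)
    qed
    also have "\<dots> = (C ^ 2 / vol w (3 / \<delta> * \<rho> k)) * (\<Sum>a\<in>T. vol a (\<rho> K / 2))"
      by (simp add: sum_distrib_left)
    also have "\<dots> \<le> (C ^ 2 / vol w (3 / \<delta> * \<rho> k)) * vol w (3 / \<delta> * \<rho> k)"
      using near that by (intro mult_left_mono overlap) (auto simp: T_def)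
    also have "\<dots> = C ^ 2" using vol_M_pos[of w k] by simp
    finally show "(\<Sum>a | a \<in> A \<and> w \<in> ball (z a k) (lam * (2 * \<rho> k)). vol a (\<rho> K) / vol (z a k) (\<rho> k)) \<le> C ^ 2"
      by (simp add: T_def)
  qed
  define b where "b a k = avg \<nu> (ball (z a k) (\<rho> k)) u" for a k
  define G where "G a k = measure m (ball (z a k) (lam * (2 * \<rho> k)))" for a k
  \<comment> \<open>Both averages are compared with the mean over the ball of radius 2\<rho>_k,
    which contains both chain balls. The factor 4 is 2 for the two comparisons times 2 for the
    doubled radius.\<close>
  have step: "\<bar>b a (Suc k) - b a k\<bar> \<le> 4 * C * \<kappa> * \<rho> k * G a k / vol (z a k) (\<rho> k)" if a: "a \<in> A" for a k
  proof -
    define T where "T = ball (z a k) (2 * \<rho> k)"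
    define c where "c = avg \<nu> T u"
    have dev: "dev T c \<le> \<kappa> * (2 * \<rho> k) * G a k"
      unfolding T_def c_def G_def
      using \<rho>0[of k] \<rho>_le[of k] inside[OF a, of "2 * \<rho> k" k] by (intro PI) auto
    have vk: "0 < vol (z a k) (\<rho> k)" and vk': "0 < vol (z a (Suc k)) (\<rho> (Suc k))"
      using \<rho>0 by (auto intro: vol_pos)
    have "\<bar>b a k - c\<bar> \<le> dev T c / vol (z a k) (\<rho> k)"
      unfolding b_def using vk \<rho>0[of k] by (intro avg_minus_const_le) (auto simp: T_def)
    also have "\<dots> \<le> C * (dev T c / vol (z a k) (\<rho> k))"
    proof -
      have "0 \<le> dev T c / vol (z a k) (\<rho> k)"
        unfolding set_lebesgue_integral_def by (intro divide_nonneg_nonneg integral_nonneg_AE) auto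
      then have "1 * (dev T c / vol (z a k) (\<rho> k)) \<le> C * (dev T c / vol (z a k) (\<rho> k))"
        using C by (intro mult_right_mono)
      then show ?thesis by (simp only: mult_1)
    qed
    finally have 1: "\<bar>b a k - c\<bar> \<le> C * (dev T c / vol (z a k) (\<rho> k))" .
    \<comment> \<open>Here q \<ge> 1/2 gives 2\<rho>_k \<le> 4\<rho>_(k+1), and \<delta> \<le> 1/2
      makes 3/\<delta> larger than 4.\<close>
    have "vol (z a k) (\<rho> k) \<le> vol (z a (Suc k)) (3 / \<delta> * \<rho> (Suc k))"
    proof (rule vol_mono, rule subsetI)
      fix v assume "v \<in> ball (z a k) (\<rho> k)"
      then have "dist (z a (Suc k)) v < 2 * \<rho> k"
        using z_step[OF a, of k] dist_triangle[of "z a (Suc k)" v "z a k"] by (simp add: dist_commute)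
      also have "2 * \<rho> k \<le> 4 * \<rho> (Suc k)"
        unfolding \<rho>_Suc using q \<rho>0[of k] by simp
      also have "\<dots> \<le> 3 / \<delta> * \<rho> (Suc k)"
        using \<open>\<delta> \<le> 1 / 2\<close> \<delta> \<rho>0[of "Suc k"] by (intro mult_right_mono) (auto simp: field_simps)
      finally show "v \<in> ball (z a (Suc k)) (3 / \<delta> * \<rho> (Suc k))" by simp
    qed
    also have "\<dots> \<le> C * vol (z a (Suc k)) (\<rho> (Suc k) / 2)"
      using \<rho>0[of "Suc k"] \<rho>_le[of "Suc k"] \<delta> by (intro comp) auto
    also have "\<dots> \<le> C * vol (z a (Suc k)) (\<rho> (Suc k))"
      using C \<rho>0[of "Suc k"] by (intro mult_left_mono vol_mono) auto
    finally have v: "vol (z a k) (\<rho> k) \<le> C * vol (z a (Suc k)) (\<rho> (Suc k))" .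
    have "\<bar>b a (Suc k) - c\<bar> \<le> dev T c / vol (z a (Suc k)) (\<rho> (Suc k))"
      unfolding b_def
    proof (intro avg_minus_const_le)
      show "ball (z a (Suc k)) (\<rho> (Suc k)) \<subseteq> T"
      proof
        fix v assume "v \<in> ball (z a (Suc k)) (\<rho> (Suc k))"
        then show "v \<in> T"
          using z_step[OF a, of k] \<rho>_mono[of k "Suc k"] dist_triangle[of "z a k" v "z a (Suc k)"]
          by (simp add: T_def)
      qed
    qed (use vk' in \<open>auto simp: T_def\<close>)
    also have "\<dots> \<le> C * (dev T c / vol (z a k) (\<rho> k))"
    proof -
      have "0 \<le> dev T c"
        unfolding set_lebesgue_integral_def by (intro integral_nonneg_AE) auto
      then have "dev T c * vol (z a k) (\<rho> k) \<le> dev T c * (C * vol (z a (Suc k)) (\<rho> (Suc k)))"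
        using v by (intro mult_left_mono)
      then show ?thesis using vk vk' by (simp add: field_simps)
    qed
    finally have "\<bar>b a (Suc k) - b a k\<bar> \<le> 2 * C * (dev T c / vol (z a k) (\<rho> k))"
      using 1 by simp
    also have "\<dots> \<le> 2 * C * (\<kappa> * (2 * \<rho> k) * G a k / vol (z a k) (\<rho> k))"
      using C dev vk by (intro mult_left_mono divide_right_mono) auto
    finally show ?thesis by (simp add: mult_ac)
  qed
  \<comment> \<open>All chains start with the same ball, about x and of radius \<rho>_0 = L r
    \<delta>, so a single constant serves every net point.\<close>
  define c0 where "c0 = avg \<nu> (ball x (L * r * \<delta>)) u"
  have dev_a: "dev (ball a (\<rho> K)) c0 \<le> \<kappa> * \<rho> K * (1 * measure m (ball a (lam * \<rho> K))) +
      (\<Sum>k<K. 4 * C * \<kappa> * \<rho> k * (vol a (\<rho> K) / vol (z a k) (\<rho> k) * G a k))" if a: "a \<in> A" for a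
  proof -
    have b0: "b a 0 = c0" and bK: "b a K = avg \<nu> (ball a (\<rho> K)) u"
      using z[OF a] by (auto simp: b_def c0_def \<rho>_def)
    have "dev (ball a (\<rho> K)) c0 \<le> dev (ball a (\<rho> K)) (b a K) + vol a (\<rho> K) * \<bar>b a K - c0\<bar>"
      by (intro dev_shift) auto
    also have "dev (ball a (\<rho> K)) (b a K) \<le> \<kappa> * \<rho> K * measure m (ball a (lam * \<rho> K))"
      unfolding bK using \<rho>0[of K] \<rho>_le[of K] inside[OF a, of "\<rho> K" K] z[OF a]
      by (intro PI) auto
    also have "vol a (\<rho> K) * \<bar>b a K - c0\<bar> \<le>
        vol a (\<rho> K) * (\<Sum>k<K. 4 * C * \<kappa> * \<rho> k * G a k / vol (z a k) (\<rho> k))"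
    proof (rule mult_left_mono)
      have "\<bar>b a K - c0\<bar> = \<bar>\<Sum>k<K. b a (Suc k) - b a k\<bar>"
        by (simp add: sum_lessThan_telescope b0)
      also have "\<dots> \<le> (\<Sum>k<K. \<bar>b a (Suc k) - b a k\<bar>)" by (rule sum_abs)
      also have "\<dots> \<le> (\<Sum>k<K. 4 * C * \<kappa> * \<rho> k * G a k / vol (z a k) (\<rho> k))"
        by (intro sum_mono step a)
      finally show "\<bar>b a K - c0\<bar> \<le> (\<Sum>k<K. 4 * C * \<kappa> * \<rho> k * G a k / vol (z a k) (\<rho> k))" .
    qed simp
    finally show ?thesis by (simp add: sum_distrib_left mult_ac)
  qed
  have "E \<subseteq> (\<Union>a\<in>A. ball a (\<rho> K))" using net by auto
  then have "dev E c0 \<le> (\<Sum>a\<in>A. dev (ball a (\<rho> K)) c0)"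
    using A(1) E_meas by (intro dev_cover) auto
  also have "\<dots> \<le> (\<Sum>a\<in>A. \<kappa> * \<rho> K * (1 * measure m (ball a (lam * \<rho> K))) +
      (\<Sum>k<K. 4 * C * \<kappa> * \<rho> k * (vol a (\<rho> K) / vol (z a k) (\<rho> k) * G a k)))"
    by (intro sum_mono dev_a)
  also have "\<dots> = \<kappa> * \<rho> K * (\<Sum>a\<in>A. 1 * measure m (ball a (lam * \<rho> K))) +
      (\<Sum>k<K. 4 * C * \<kappa> * \<rho> k * (\<Sum>a\<in>A. vol a (\<rho> K) / vol (z a k) (\<rho> k) * G a k))"
    by (simp only: sum.distrib sum_distrib_left sum.swap[of _ "{..<K}" A])
  also have "\<dots> \<le> \<kappa> * \<rho> K * (C * mU) + (\<Sum>k<K. 4 * C * \<kappa> * \<rho> k * (C ^ 2 * mU))"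
    unfolding G_def using sum_last sum_level C \<kappa> \<rho>0
    by (intro add_mono mult_left_mono sum_mono) (auto simp: less_imp_le)
  also have "\<dots> = \<kappa> * mU * (C * \<rho> K + 4 * C ^ 3 * (\<Sum>k<K. \<rho> k))"
    by (simp add: algebra_simps sum_distrib_left sum_distrib_right power2_eq_square power3_eq_cube)
  \<comment> \<open>The radii sum to L r (1 - q^K) \<le> L r, which removes the dependence on
    K.\<close>
  also have "\<dots> \<le> \<kappa> * mU * (C ^ 3 * (L * r) + 4 * C ^ 3 * (L * r))"
  proof (intro mult_left_mono add_mono mult_mono)
    show "C \<le> C ^ 3" using C by (intro self_le_power) auto
    show "\<rho> K \<le> L * r"
      using \<rho>_le[of K] Lr \<open>\<delta> \<le> 1 / 2\<close> mult_left_mono[of \<delta> 1 "L * r"] by simp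
    have "(\<Sum>k<K. \<rho> k) = L * r * (1 - q ^ K)"
    proof (induction K)
      case (Suc n)
      then show ?case by (simp add: \<rho>_def q_def algebra_simps)
    qed simp
    also have "\<dots> \<le> L * r * 1" using Lr qk[of K] by (intro mult_left_mono) auto
    finally show "(\<Sum>k<K. \<rho> k) \<le> L * r" by simp
  qed (use C \<kappa> mU Lr \<rho>0 in \<open>auto simp: less_imp_le intro!: sum_nonneg\<close>)
  also have "\<dots> = 5 * C ^ 3 * L * \<kappa> * r * mU" by (simp add: algebra_simps)
  finally show ?thesis
    by (simp add: E_def c0_def mU_def q_def)
qed

text \<open>The closed balls of the chaining estimate exhaust the open ball, and both the bound and
  the reference constant are independent of K. Returning from that constant to the average over the
  ball doubles the factor 5.\<close>

lemma ball_dev_estimate: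
  fixes m :: "'a measure"
  assumes qc: "quasiconvex L (UNIV :: 'a set)" and L: "1 \<le> L" and lam: "1 \<le> lam"
    and \<delta>: "0 < \<delta>" "2 * lam * \<delta> \<le> 1" and r: "0 < r" and C: "1 \<le> C" and \<kappa>: "0 \<le> \<kappa>"
    and comp: "\<And>w z \<rho>. 0 < \<rho> \<Longrightarrow> \<rho> \<le> L * r * \<delta> \<Longrightarrow> dist w z \<le> 3 / \<delta> * \<rho> \<Longrightarrow>
      vol w (3 / \<delta> * \<rho>) \<le> C * vol z (\<rho> / 2)"
    and lower: "\<And>s. 0 < s \<Longrightarrow> \<exists>e>0. \<forall>a\<in>ball x r. e \<le> vol a s"
    and m: "finite_measure m" "sets m = sets \<nu>"
    and PI: "\<And>z s. 0 < s \<Longrightarrow> s \<le> 2 * (L * r * \<delta>) \<Longrightarrow> ball z (lam * s) \<subseteq> ball x (L * r) \<Longrightarrow>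
      dev (ball z s) (avg \<nu> (ball z s) u) \<le> \<kappa> * s * measure m (ball z (lam * s))"
  shows "dev (ball x r) (avg \<nu> (ball x r) u) \<le> 10 * C ^ 3 * L * \<kappa> * r * measure m UNIV"
proof -
  define q where "q = 1 - \<delta>"
  define c where "c = avg \<nu> (ball x (L * r * \<delta>)) u"
  define S where "S K = cball x (r * (1 - q ^ K))" for K
  have "1 * \<delta> \<le> lam * \<delta>" using lam \<delta> by (intro mult_right_mono) auto
  moreover have "2 * (lam * \<delta>) \<le> 1" using \<delta> by (simp add: mult.assoc)
  ultimately have q: "0 < q" "q < 1" using \<delta>(1) unfolding q_def by linarith+
  have "incseq S"
    unfolding S_def
    by (intro monoI subset_cball mult_left_mono diff_left_mono power_decreasing) (use q r in auto)
  have S_Un: "(\<Union>K. S K) = ball x r"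
  proof (intro equalityI subsetI)
    fix y assume "y \<in> (\<Union>K. S K)"
    then obtain K where "dist x y \<le> r * (1 - q ^ K)" by (auto simp: S_def)
    also have "\<dots> < r * 1" using r q by (intro mult_strict_left_mono) auto
    finally show "y \<in> ball x r" by simp
  next
    fix y assume "y \<in> ball x r"
    then have "0 < 1 - dist x y / r" using r by (simp add: field_simps)
    then obtain K where "q ^ K < 1 - dist x y / r"
      using real_arch_pow_inv[of "1 - dist x y / r" q] q by blast
    then have "dist x y \<le> r * (1 - q ^ K)" using r by (simp add: field_simps)
    then show "y \<in> (\<Union>K. S K)" by (auto simp: S_def)
  qed
  have "(\<lambda>K. dev (S K) c) \<longlonglongrightarrow> dev (\<Union>K. S K) c"
  proof (rule set_integral_cont_up)
    show "S K \<in> sets \<nu>" for K using borel_sets by (auto simp: S_def)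
    show "set_integrable \<nu> (\<Union>K. S K) (\<lambda>y. \<bar>u y - c\<bar>)"
      unfolding S_Un by (intro dev_integrable fmeasurable_ball)
  qed fact
  then have "dev (ball x r) c \<le> 5 * C ^ 3 * L * \<kappa> * r * measure m UNIV"
    unfolding S_Un
  proof (rule LIMSEQ_le_const2)
    show "\<exists>N. \<forall>K\<ge>N. dev (S K) c \<le> 5 * C ^ 3 * L * \<kappa> * r * measure m UNIV"
      unfolding S_def q_def c_def
      using chain_dev_estimate[OF qc L lam \<delta> r C \<kappa> comp lower m PI] by blast
  qed
  moreover have "dev (ball x r) (avg \<nu> (ball x r) u) \<le> 2 * dev (ball x r) c"
    using r vol_pos by (intro dev_avg_le) auto
  ultimately show ?thesis by simp
qed

end

section \<open>The Poincare inequality\<close>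

text \<open>Replaces Hoelder's inequality: it makes the right-hand side of the Poincare inequality
  additive in the set, at the price of the free parameter t.\<close>

lemma powr_inverse_le_linear:
  fixes a t p :: real
  assumes "1 \<le> p" "0 \<le> a" "0 \<le> t" "t = 0 \<Longrightarrow> a = 0"
  shows "a powr (1 / p) \<le> t powr (1 / p - 1) * (t + a)"
proof (cases "a = 0")
  case True
  then show ?thesis using assms by simp
next
  case False
  then have pos: "0 < a" "0 < t" using assms by (auto simp: less_le)
  have eq: "v powr (1 / p) = v powr (1 / p - 1) * v" if "0 < v" for v
    using that powr_add[of v "1 / p - 1" 1] by simp
  \<comment> \<open>The exponent 1/p - 1 is at most 0. If a \<le> t, the summand t suffices;
    otherwise a^(1/p - 1) \<le> t^(1/p - 1) and the summand a suffices.\<close>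
  show ?thesis
  proof (cases "a \<le> t")
    case True
    have "a powr (1 / p) \<le> t powr (1 / p)"
      using True pos assms by (intro powr_mono2) auto
    also have "\<dots> \<le> t powr (1 / p - 1) * (t + a)"
      unfolding eq[OF pos(2)] using pos by (intro mult_left_mono) auto
    finally show ?thesis .
  next
    case False
    have "a powr (1 / p - 1) \<le> t powr (1 / p - 1)"
      using False pos assms by (intro powr_mono2') auto
    then have "a powr (1 / p - 1) * a \<le> t powr (1 / p - 1) * (t + a)"
      using pos by (intro mult_mono) auto
    then show ?thesis using eq[OF pos(1)] by simp
  qed
qed

lemma diameter_ball_le:
  fixes x :: "'a::metric_space"
  assumes "0 < r"
  shows "diameter (ball x r) \<le> 2 * r"
proof -
  have "dist a b \<le> 2 * r" if "a \<in> ball x r" "b \<in> ball x r" for a b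
    using that dist_triangle3[of a b x] by (simp add: dist_commute)
  then show ?thesis
    using assms unfolding diameter_def
    by (auto intro!: cSUP_least)
qed

lemma borel_measurable_ennpow [measurable]: "(\<lambda>x. ennpow x p) \<in> borel_measurable borel"
  unfolding ennpow_def by measurable

section \<open>The inequality with the radius in place of the diameter\<close>

context ball_finite_measure
begin

text \<open>This makes the separated nets finite. It is the volume comparison with \<rho> = 2s, the
  factor M being chosen so that B(x,r) lies in B(x,2Ms).\<close>

lemma vol_lower_bound:
  assumes qc: "quasiconvex L (UNIV :: 'a set)" and L: "1 \<le> L"
    and D: "vol_doubling R C" and "0 < R" "0 < r" "0 < s"
  shows "\<exists>e>0. \<forall>a\<in>ball x r. e \<le> vol a s"
proof -
  define M where "M = max 1 (r / (2 * s))"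
  have rM: "r \<le> M * (2 * s)"
  proof -
    have "r / (2 * s) \<le> M" by (simp add: M_def)
    then show ?thesis using \<open>0 < s\<close> by (simp add: field_simps)
  qed
  obtain C' where C': "1 \<le> C'" "\<And>w z \<rho>. 0 < \<rho> \<Longrightarrow> \<rho> \<le> 2 * s \<Longrightarrow> dist w z \<le> M * \<rho> \<Longrightarrow>
      vol w (M * \<rho>) \<le> C' * vol z (\<rho> / 2)"
    using vol_comparable[OF qc L D \<open>0 < R\<close>, of "2 * s" M] \<open>0 < s\<close> by (auto simp: M_def)
  have "vol x r / C' \<le> vol a s" if "a \<in> ball x r" for a
  proof -
    have "vol x r \<le> vol x (M * (2 * s))" using rM by (intro vol_mono) auto
    also have "\<dots> \<le> C' * vol a (2 * s / 2)"
      using that rM \<open>0 < s\<close> by (intro C') auto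
    finally show ?thesis using C'(1) by (simp add: field_simps)
  qed
  moreover have "0 < vol x r / C'" using vol_pos[OF \<open>0 < r\<close>] C'(1) by simp
  ultimately show ?thesis by blast
qed

lemma poincare_radius:
  assumes p: "1 \<le> p" and qc: "quasiconvex L (UNIV :: 'a set)" and L: "1 \<le> L"
    and R0: "0 < R0" and D: "vol_doubling R0 Cd" and lam: "1 \<le> lam" and P: "poincare \<nu> p lam R0"
    and R1: "0 < R1"
  obtains C where "0 \<le> C" "\<And>x r u g. 0 < r \<Longrightarrow> r \<le> R1 \<Longrightarrow> u \<in> borel_measurable \<nu> \<Longrightarrow>
    bounded (range u) \<Longrightarrow> upper_gradient u g \<Longrightarrow>
    (\<integral>\<^sup>+ y\<in>ball x (L * r). ennpow (g y) p \<partial>\<nu>) \<noteq> \<infinity> \<Longrightarrow>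
    avg \<nu> (ball x r) (\<lambda>y. \<bar>u y - avg \<nu> (ball x r) u\<bar>) \<le>
      C * r * (enn2real (\<integral>\<^sup>+ y\<in>ball x (L * r). ennpow (g y) p \<partial>\<nu>) / vol x (L * r)) powr (1 / p)"
proof -
  \<comment> \<open>The three bounds keep the dilated chain balls inside B(x,Lr), keep all radii up
    to 2 L r \<delta> below \<open>R0\<close>, and make L r \<delta>/2 at most r, which is used to
    compare B(x,Lr) with B(x,r).\<close>
  define \<delta> where "\<delta> = min (1 / (2 * lam)) (min (R0 / (2 * L * R1)) (1 / L))"
  have \<delta>0: "0 < \<delta>" using lam R0 R1 L by (auto simp: \<delta>_def)
  have "\<delta> \<le> 1 / (2 * lam)" "\<delta> \<le> R0 / (2 * L * R1)" "\<delta> \<le> 1 / L" by (auto simp: \<delta>_def)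
  then have \<delta>_lam: "2 * lam * \<delta> \<le> 1" and \<delta>_R: "2 * (L * R1 * \<delta>) \<le> R0" and \<delta>_L: "L * \<delta> \<le> 1"
    using lam R1 L by (auto simp: field_simps)
  have "\<delta> \<le> 1"
  proof -
    have "1 * \<delta> \<le> L * \<delta>" using L \<delta>0 by (intro mult_right_mono) auto
    with \<delta>_L show ?thesis by simp
  qed
  then have "1 \<le> 3 / \<delta>" using \<delta>0 by (simp add: field_simps)
  then obtain C where C: "1 \<le> C" and comp: "\<And>w z \<rho>. 0 < \<rho> \<Longrightarrow> \<rho> \<le> L * R1 * \<delta> \<Longrightarrow>
      dist w z \<le> 3 / \<delta> * \<rho> \<Longrightarrow> vol w (3 / \<delta> * \<rho>) \<le> C * vol z (\<rho> / 2)"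
    using vol_comparable[OF qc L D R0, of "L * R1 * \<delta>" "3 / \<delta>"] L R1 \<delta>0 by auto
  obtain C0 where "\<forall>x r u g. 0 < r \<and> r \<le> R0 \<and> u \<in> borel_measurable \<nu> \<and> bounded (range u) \<and>
      upper_gradient u g \<longrightarrow> (\<integral>\<^sup>+ y\<in>ball x (lam * r). ennpow (g y) p \<partial>\<nu>) = \<infinity> \<or>
      avg \<nu> (ball x r) (\<lambda>y. \<bar>u y - avg \<nu> (ball x r) u\<bar>) \<le> C0 * diameter (ball x r) *
        (enn2real (\<integral>\<^sup>+ y\<in>ball x (lam * r). ennpow (g y) p \<partial>\<nu>) / vol x (lam * r)) powr (1 / p)"
    using P unfolding poincare_def Let_def by (rule exE)
  note C0 = this[rule_format]
  \<comment> \<open>The definition of \<open>poincare\<close> allows a negative constant;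
    monotonicity in the other factors needs a nonnegative one.\<close>
  define C1 where "C1 = max 0 C0"
  show ?thesis
  proof (rule that[of "40 * C ^ 4 * L * C1"])
    show "0 \<le> 40 * C ^ 4 * L * C1" using C L by (simp add: C1_def)
  next
    fix x r and u :: "'a \<Rightarrow> real" and g
    assume r: "0 < r" "r \<le> R1" and u: "u \<in> borel_measurable \<nu>" "bounded (range u)"
      and ug: "upper_gradient u g"
      and fin: "(\<integral>\<^sup>+ y\<in>ball x (L * r). ennpow (g y) p \<partial>\<nu>) \<noteq> \<infinity>"
    interpret bounded_function \<nu> u using u by unfold_locales
    define \<Omega> where "\<Omega> = ball x (L * r)"
    define G where "G y = ennpow (g y) p" for y
    have "g \<in> borel_measurable \<nu>"
      using ug borel_sets space_UNIV by (auto simp: upper_gradient_def measurable_def)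
    then have G [measurable]: "G \<in> borel_measurable \<nu>"
      unfolding G_def by measurable
    have \<Omega> [measurable]: "\<Omega> \<in> sets \<nu>" by (simp add: \<Omega>_def)
    define J where "J S = (\<integral>\<^sup>+ y\<in>S. G y \<partial>\<nu>)" for S
    have J\<Omega>: "J \<Omega> \<noteq> \<infinity>" using fin by (simp add: J_def \<Omega>_def G_def)
    have J_mono: "J S \<le> J \<Omega>" if "S \<subseteq> \<Omega>" for S
      unfolding J_def using that by (intro nn_integral_mono) (auto simp: indicator_def)
    have J_fin: "J S < \<infinity>" if "S \<subseteq> \<Omega>" for S
      using J_mono[OF that] J\<Omega> by (auto simp: less_top[symmetric] top_unique)
    have v\<Omega>: "0 < measure \<nu> \<Omega>" using r L vol_pos by (simp add: \<Omega>_def)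
    \<comment> \<open>The free parameter of the linearisation is the mean of g^p over \<Omega>. It
      is the same for all chain balls, so the linearised bounds can be added.\<close>
    define t where "t = enn2real (J \<Omega>) / measure \<nu> \<Omega>"
    have t: "0 \<le> t" by (simp add: t_def)
    have t\<Omega>: "enn2real (J \<Omega>) = t * measure \<nu> \<Omega>" using v\<Omega> by (simp add: t_def)
    define m where "m = density \<nu> (\<lambda>y. (ennreal t + G y) * indicator \<Omega> y)"
    have em: "emeasure m S = ennreal (t * measure \<nu> (S \<inter> \<Omega>) + enn2real (J (S \<inter> \<Omega>)))"
      if [measurable]: "S \<in> sets \<nu>" for S
    proof -
      have "emeasure m S = (\<integral>\<^sup>+ y. (ennreal t + G y) * indicator \<Omega> y * indicator S y \<partial>\<nu>)"
        unfolding m_def by (rule emeasure_density) auto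
      also have "\<dots> = (\<integral>\<^sup>+ y. ennreal t * indicator (S \<inter> \<Omega>) y + G y * indicator (S \<inter> \<Omega>) y \<partial>\<nu>)"
        by (intro nn_integral_cong) (auto simp: indicator_def)
      also have "\<dots> = ennreal t * emeasure \<nu> (S \<inter> \<Omega>) + J (S \<inter> \<Omega>)"
        unfolding J_def by (subst nn_integral_add) (auto simp: nn_integral_cmult_indicator)
      also have "emeasure \<nu> (S \<inter> \<Omega>) = ennreal (measure \<nu> (S \<inter> \<Omega>))"
      proof (rule emeasure_eq_measure2)
        show "S \<inter> \<Omega> \<in> fmeasurable \<nu>"
          by (rule fmeasurableI2[of \<Omega>]) (auto simp: \<Omega>_def)
      qed
      also have "J (S \<inter> \<Omega>) = ennreal (enn2real (J (S \<inter> \<Omega>)))"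
        using J_fin[of "S \<inter> \<Omega>"] by simp
      finally show ?thesis
        using t by (simp add: ennreal_mult ennreal_plus)
    qed
    have meas_m: "measure m S = t * measure \<nu> S + enn2real (J S)" if "S \<in> sets \<nu>" "S \<subseteq> \<Omega>" for S
      using em[OF that(1)] that(2) t
      by (intro measure_eq_emeasure_eq_ennreal) (auto simp: Int_absorb2)
    have sets_m: "sets m = sets \<nu>" by (simp add: m_def)
    have fin_m: "finite_measure m"
    proof
      have "space m = UNIV" by (simp add: m_def space_UNIV)
      then show "emeasure m (space m) \<noteq> \<infinity>"
        using em[of UNIV] sets.top[of \<nu>] by (simp add: space_UNIV)
    qed
    have mU: "measure m UNIV = 2 * t * measure \<nu> \<Omega>"
      using em[of UNIV] sets.top[of \<nu>] t t\<Omega>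
      by (intro measure_eq_emeasure_eq_ennreal) (auto simp: space_UNIV)
    \<comment> \<open>The factor 2 comes from bounding the diameter by twice the radius. With total
      mass 2 t \<nu>(\<Omega>) for \<open>m\<close>, the factor 10 of the chain argument becomes
      40.\<close>
    define \<kappa> where "\<kappa> = 2 * C1 * t powr (1 / p - 1)"
    have \<kappa>: "0 \<le> \<kappa>" by (simp add: \<kappa>_def C1_def)
    have PI: "dev (ball z s) (avg \<nu> (ball z s) u) \<le> \<kappa> * s * measure m (ball z (lam * s))"
      if s: "0 < s" "s \<le> 2 * (L * r * \<delta>)" and sub: "ball z (lam * s) \<subseteq> ball x (L * r)" for z s
    proof -
      define b where "b = ball z (lam * s)"
      have b: "b \<subseteq> \<Omega>" "b \<in> sets \<nu>" using sub by (auto simp: b_def \<Omega>_def)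
      have vb: "0 < measure \<nu> b" using s lam vol_pos by (simp add: b_def)
      have vs: "0 < vol z s" using s vol_pos by simp
      have vsb: "vol z s \<le> measure \<nu> b"
        unfolding b_def using s lam mult_right_mono[of 1 lam s] by (intro vol_mono subset_ball) auto
      define a where "a = enn2real (J b) / measure \<nu> b"
      have a: "0 \<le> a" by (simp add: a_def)
      \<comment> \<open>Since \<open>0 powr\<close> any exponent is 0, the linear bound would fail
        for t = 0 and a > 0. But t = 0 means that g^p has integral 0 over \<Omega>, hence over the
        smaller ball.\<close>
      have ta: "a = 0" if "t = 0"
      proof -
        have "enn2real (J \<Omega>) = 0" using that t\<Omega> by simp
        then have "J \<Omega> = 0" using J\<Omega> by (auto simp: enn2real_eq_0_iff)
        then show ?thesis using J_mono[OF b(1)] by (simp add: a_def)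
      qed
      have "s \<le> R0"
      proof -
        have "L * r * \<delta> \<le> L * R1 * \<delta>" using r L \<delta>0 by (intro mult_mono) auto
        with s \<delta>_R show ?thesis by linarith
      qed
      then have "avg \<nu> (ball z s) (\<lambda>y. \<bar>u y - avg \<nu> (ball z s) u\<bar>)
          \<le> C0 * diameter (ball z s) * a powr (1 / p)"
        using C0[of s u g z] s(1) u ug J_fin[OF b(1)] by (auto simp: a_def J_def b_def G_def)
      also have "\<dots> \<le> C1 * (2 * s) * (t powr (1 / p - 1) * (t + a))"
        using diameter_ball_le[OF s(1), of z] s a t ta p powr_inverse_le_linear[of p a t]
        by (intro mult_mono) (auto simp: C1_def diameter_ge_0)
      finally have "dev (ball z s) (avg \<nu> (ball z s) u) \<le>
          vol z s * (C1 * (2 * s) * (t powr (1 / p - 1) * (t + a)))"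
        using vs by (simp add: avg_def field_simps)
      also have "\<dots> = \<kappa> * s * (vol z s * (t + a))"
        by (simp add: \<kappa>_def mult_ac)
      also have "\<dots> \<le> \<kappa> * s * (measure \<nu> b * (t + a))"
        using \<kappa> s vsb t a by (intro mult_left_mono mult_right_mono) auto
      also have "measure \<nu> b * (t + a) = measure m b"
        using meas_m[OF b(2,1)] vb by (simp add: a_def field_simps)
      finally show ?thesis by (simp add: b_def)
    qed
    have comp': "vol w (3 / \<delta> * \<rho>) \<le> C * vol z (\<rho> / 2)"
      if "0 < \<rho>" "\<rho> \<le> L * r * \<delta>" "dist w z \<le> 3 / \<delta> * \<rho>" for w z \<rho>
    proof (rule comp[OF that(1) _ that(3)])
      have "L * r * \<delta> \<le> L * R1 * \<delta>" using r L \<delta>0 by (intro mult_mono) auto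
      with that show "\<rho> \<le> L * R1 * \<delta>" by simp
    qed
    have "dev (ball x r) (avg \<nu> (ball x r) u) \<le> 10 * C ^ 3 * L * \<kappa> * r * measure m UNIV"
      by (rule ball_dev_estimate[OF qc L lam \<delta>0 \<delta>_lam r(1) C \<kappa> comp' _ fin_m sets_m PI])
        (use vol_lower_bound[OF qc L D R0 r(1)] in auto)
    also have "\<dots> = 40 * C ^ 3 * L * C1 * r * (t powr (1 / p - 1) * t) * measure \<nu> \<Omega>"
      by (simp add: mU \<kappa>_def)
    also have "t powr (1 / p - 1) * t = t powr (1 / p)"
      using t powr_add[of t "1 / p - 1" 1] by (cases "t = 0") auto
    also have "40 * C ^ 3 * L * C1 * r * t powr (1 / p) * measure \<nu> \<Omega> \<le>
        40 * C ^ 3 * L * C1 * r * t powr (1 / p) * (C * vol x r)"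
    proof (rule mult_left_mono)
      \<comment> \<open>The chain argument leaves the volume of B(x,Lr), while the average divides
        by that of B(x,r); this comparison is the fourth factor \<open>C\<close>.\<close>
      have "measure \<nu> \<Omega> \<le> vol x (3 / \<delta> * (L * r * \<delta>))"
        unfolding \<Omega>_def using \<delta>0 L r by (intro vol_mono subset_ball) auto
      also have "\<dots> \<le> C * vol x (L * r * \<delta> / 2)"
        using \<delta>0 L r by (intro comp') auto
      also have "\<dots> \<le> C * vol x r"
      proof -
        have "L * \<delta> * r \<le> 1 * r" using \<delta>_L r by (intro mult_right_mono) auto
        then have "L * r * \<delta> / 2 \<le> r" using r by (simp add: mult_ac)
        then show ?thesis using C by (intro mult_left_mono vol_mono subset_ball) auto
      qed
      finally show "measure \<nu> \<Omega> \<le> C * vol x r" .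
    qed (use C L r in \<open>auto simp: C1_def\<close>)
    finally have "dev (ball x r) (avg \<nu> (ball x r) u) \<le> 40 * C ^ 4 * L * C1 * r * t powr (1 / p) * vol x r"
      by (simp add: power4_eq_xxxx power3_eq_cube mult_ac)
    then have "avg \<nu> (ball x r) (\<lambda>y. \<bar>u y - avg \<nu> (ball x r) u\<bar>) \<le> 40 * C ^ 4 * L * C1 * r * t powr (1 / p)"
      using vol_pos[OF r(1), of x] by (simp add: avg_def pos_divide_le_eq)
    then show "avg \<nu> (ball x r) (\<lambda>y. \<bar>u y - avg \<nu> (ball x r) u\<bar>) \<le> 40 * C ^ 4 * L * C1 * r *
        (enn2real (\<integral>\<^sup>+ y\<in>ball x (L * r). ennpow (g y) p \<partial>\<nu>) / vol x (L * r)) powr (1 / p)"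
      by (simp add: t_def J_def \<Omega>_def G_def)
  qed
qed

end

text \<open>The diameter of a ball is comparable to its radius, unless the ball is the whole space and
  its radius can be decreased.\<close>

lemma quasiconvex_ball_radius:
  fixes x :: "'a::metric_space"
  assumes qc: "quasiconvex L (UNIV :: 'a set)" and L: "1 \<le> L" and r: "0 < r"
    and two: "\<exists>a b :: 'a. a \<noteq> b"
  obtains r' where "0 < r'" "r' \<le> r" "r' \<le> 2 * diameter (ball x r)"
    "ball x r' = ball x r" "ball x (L * r') = ball x (L * r)"
proof (cases "r \<le> 2 * diameter (ball x r)")
  case True
  with r show ?thesis by (intro that[of r]) auto
next
  case False
  define d where "d = diameter (ball x r)"
  have small: "dist x w \<le> d" if "dist x w < r" for w
    unfolding d_def using that r by (intro diameter_bounded_bound) auto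
  \<comment> \<open>A path to a point outside the ball would cross the sphere of radius 3r/4 about
    x, but points of the ball are at distance at most d < r/2 from x.\<close>
  have all: "dist x y < r" for y
  proof (rule ccontr)
    assume y: "\<not> dist x y < r"
    obtain Z where Z: "Z 0 = x" "Z (L * dist x y) = y" "dist x y \<le> L * dist x y"
      "\<And>s t. 0 \<le> s \<Longrightarrow> s \<le> t \<Longrightarrow> t \<le> L * dist x y \<Longrightarrow> dist (Z s) (Z t) \<le> t - s"
      using quasiconvex_Lipschitz_path[OF qc, of x y] by metis
    have "1-lipschitz_on {0..L * dist x y} Z"
    proof (rule lipschitz_onI)
      fix s t assume "s \<in> {0..L * dist x y}" "t \<in> {0..L * dist x y}"
      then show "dist (Z s) (Z t) \<le> 1 * dist s t"
        using Z(4)[of s t] Z(4)[of t s] by (cases "s \<le> t") (auto simp: dist_real_def dist_commute)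
    qed simp
    then have "continuous_on {0..L * dist x y} Z"
      by (rule lipschitz_on_continuous_on)
    then have "\<exists>t\<ge>0. t \<le> L * dist x y \<and> dist x (Z t) = 3 / 4 * r"
      using y r Z L by (intro IVT') (auto intro!: continuous_intros)
    then obtain w where "dist x w = 3 / 4 * r" by blast
    with small[of w] False r show False by (simp add: d_def)
  qed
  have d_bound: "dist x y \<le> d" for y using small all by blast
  have "0 < d"
  proof (rule ccontr)
    assume "\<not> 0 < d"
    then have "x = y" for y
      using d_bound[of y] zero_le_dist[of x y] by (metis dist_eq_0_iff not_less order_antisym order_trans)
    with two show False by metis
  qed
  \<comment> \<open>No point is farther than d from x, and d > 0 because there are two points, so
    the radius 2d already gives the whole space.\<close>
  have full: "ball x s = UNIV" if "2 * d \<le> s" for s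
  proof -
    have "dist x y < s" for y
      using d_bound[of y] that \<open>0 < d\<close> by linarith
    then show ?thesis by auto
  qed
  have "1 * (2 * d) \<le> L * (2 * d)" "1 * r \<le> L * r"
    using L \<open>0 < d\<close> r by (auto intro!: mult_right_mono)
  then have "2 * d \<le> L * (2 * d)" "2 * d \<le> L * r" "2 * d \<le> r"
    using False by (auto simp: d_def)
  then have "ball x (2 * d) = ball x r" "ball x (L * (2 * d)) = ball x (L * r)"
    by (simp_all add: full)
  moreover have "2 * d \<le> 2 * diameter (ball x r)" by (simp add: d_def)
  ultimately show ?thesis
    using \<open>0 < d\<close> \<open>2 * d \<le> r\<close> by (intro that[of "2 * d"]) auto
qed

theorem theorem5p3:
  fixes \<nu> :: "'a::metric_space measure" and p L R0 R1 lam :: real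
  assumes "1 \<le> p"
    and "quasiconvex L (UNIV :: 'a set)"
    and "space \<nu> = UNIV" and "sets borel \<subseteq> sets \<nu>" and "complete_measure \<nu>"
    and "\<And>x r. 0 < r \<Longrightarrow> 0 < emeasure \<nu> (ball x r) \<and> emeasure \<nu> (ball x r) < \<infinity>"
    and "0 < R0"
    and "doubling_upto \<nu> R0"
    and "1 \<le> lam" and "poincare \<nu> p lam R0"
    and "0 < R1"
  shows "poincare \<nu> p L R1"
proof -
  interpret ball_finite_measure \<nu>
    using assms(3,4,6) by unfold_locales
  show ?thesis
  proof (cases "\<exists>a b :: 'a. a \<noteq> b")
    case True
    then obtain a b :: 'a where "a \<noteq> b" by blast
    then have L: "1 \<le> L"
      using quasiconvex_Lipschitz_path[OF assms(2), of a b] 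
      by (metis mult_le_cancel_right1 zero_less_dist_iff not_less)
    obtain Cd where D: "vol_doubling R0 Cd"
      using vol_doubling_upto[OF assms(8)] .
    obtain C where C: "0 \<le> C" "\<And>x r u g. 0 < r \<Longrightarrow> r \<le> R1 \<Longrightarrow> u \<in> borel_measurable \<nu> \<Longrightarrow>
      bounded (range u) \<Longrightarrow> upper_gradient u g \<Longrightarrow>
      (\<integral>\<^sup>+ y\<in>ball x (L * r). ennpow (g y) p \<partial>\<nu>) \<noteq> \<infinity> \<Longrightarrow>
      avg \<nu> (ball x r) (\<lambda>y. \<bar>u y - avg \<nu> (ball x r) u\<bar>) \<le>
        C * r * (enn2real (\<integral>\<^sup>+ y\<in>ball x (L * r). ennpow (g y) p \<partial>\<nu>) / vol x (L * r)) powr (1 / p)"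
      using poincare_radius[OF assms(1,2) L assms(7) D assms(9,10,11)] by blast
    show ?thesis
      unfolding poincare_def Let_def
    proof (intro exI[of _ "2 * C"] allI impI, subst disj_commute, intro disjCI)
      fix x r and u :: "'a \<Rightarrow> real" and g
      assume *: "0 < r \<and> r \<le> R1 \<and> u \<in> borel_measurable \<nu> \<and> bounded (range u) \<and> upper_gradient u g"
        and fin: "(\<integral>\<^sup>+ y\<in>ball x (L * r). ennpow (g y) p \<partial>\<nu>) \<noteq> \<infinity>"
      obtain r' where r': "0 < r'" "r' \<le> r" "r' \<le> 2 * diameter (ball x r)"
        and eq: "ball x r' = ball x r" "ball x (L * r') = ball x (L * r)"
        \<comment> \<open>Replacing r by r' changes neither ball, hence neither side except for the
          radius; r' is at most twice the diameter, which accounts for \<open>2 * C\<close>.\<close>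
        using quasiconvex_ball_radius[OF assms(2) L _ True] * by metis
      have "avg \<nu> (ball x r) (\<lambda>y. \<bar>u y - avg \<nu> (ball x r) u\<bar>) \<le> C * r' *
          (enn2real (\<integral>\<^sup>+ y\<in>ball x (L * r). ennpow (g y) p \<partial>\<nu>) / vol x (L * r)) powr (1 / p)"
        using C(2)[of r' u g x] r' * fin unfolding eq by auto
      also have "\<dots> \<le> 2 * C * diameter (ball x r) *
          (enn2real (\<integral>\<^sup>+ y\<in>ball x (L * r). ennpow (g y) p \<partial>\<nu>) / vol x (L * r)) powr (1 / p)"
        using mult_left_mono[OF r'(3) C(1)] by (intro mult_right_mono) (auto simp: mult_ac)
      finally show "avg \<nu> (ball x r) (\<lambda>y. \<bar>u y - avg \<nu> (ball x r) u\<bar>) \<le> 2 * C * diameter (ball x r) *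
          (enn2real (\<integral>\<^sup>+ y\<in>ball x (L * r). ennpow (g y) p \<partial>\<nu>) / vol x (L * r)) powr (1 / p)" .
    qed
  next
    case False
    \<comment> \<open>On a one-point space quasiconvexity puts no restriction on \<open>L\<close>,
      so B(x,Lr) may be empty. As u is constant, the left-hand side vanishes and the constant 0
      works.\<close>
    show ?thesis
      unfolding poincare_def Let_def
    proof (intro exI[of _ 0] allI impI disjI2)
      fix x :: 'a and r and u :: "'a \<Rightarrow> real" and g :: "'a \<Rightarrow> ennreal"
      assume *: "0 < r \<and> r \<le> R1 \<and> u \<in> borel_measurable \<nu> \<and> bounded (range u) \<and> upper_gradient u g"
      then interpret bounded_function \<nu> u by unfold_locales auto
      have "(\<lambda>y. \<bar>u y - u x\<bar>) = (\<lambda>_. 0)" using False by (metis abs_zero diff_self)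
      then have "dev (ball x r) (u x) = 0" by simp
      moreover have "dev (ball x r) (avg \<nu> (ball x r) u) \<le> 2 * dev (ball x r) (u x)"
        using * vol_pos by (intro dev_avg_le) auto
      ultimately have "avg \<nu> (ball x r) (\<lambda>y. \<bar>u y - avg \<nu> (ball x r) u\<bar>) \<le> 0"
        unfolding avg_def[of \<nu> "ball x r" "\<lambda>y. \<bar>u y - avg \<nu> (ball x r) u\<bar>"]
        by (intro divide_nonpos_nonneg) auto
      then show "avg \<nu> (ball x r) (\<lambda>y. \<bar>u y - avg \<nu> (ball x r) u\<bar>) \<le> 0 * diameter (ball x r) *
          (enn2real (\<integral>\<^sup>+ y\<in>ball x (L * r). ennpow (g y) p \<partial>\<nu>) / vol x (L * r)) powr (1 / p)"
        by simp
    qed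
  qed
qed

end
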